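(* Let $n\geq 0$ be an integer. The elementary abelian $2$-group $G$ of order $2^n$ is the affine symmetry group of one of its orbit polytopes if and only if $n\notin\{2,3,4\}$. (Here "$G$ is the affine symmetry group of one of its orbit polytopes" means that there are a representation $D\colon G\to\mathrm{GL}(d,\mathbb{R})$ and a vector $v\in\mathbb{R}^d$ such that the natural homomorphism from $G$ to the affine symmetry group of $P(G,v)$ is an isomorphism.)
   Context: For a representation $D\colon G\to\mathrm{GL}(d,\mathbb{R})$ of a finite group $G$ and $v\in\mathbb{R}^d$, the orbit polytope is $P(G,v)=\operatorname{conv}\{D(g)v\mid g\in G\}$. An affine symmetry of a polytope $P\subset\mathbb{R}^d$ is a bijection of $P$ that is the restriction of an affine map $\mathbb{R}^d\to\mathbb{R}^d$. Each $D(g)$ restricts to an affine symmetry of $P(G,v)$, which gives the natural homomorphism from $G$ to the group of affine symmetries of $P(G,v)$. *)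

theory Defs
  imports "HOL-Algebra.Bij" "HOL-Algebra.Coset" "Jordan_Normal_Form.Matrix"
begin

text \<open>
  The dimension \<open>d\<close> is existentially quantified in the statement, so the space \<open>\<real>\<^sup>d\<close> is
  \<open>carrier_vec d\<close> and not a type. The type of vectors is then not a real vector space, and convexity
  is spelled out relative to the carrier; the hull is the library's generic \<open>hull\<close> operator, exactly
  as in \<open>convex hull S\<close>.
\<close>

definition convex_vec :: "nat \<Rightarrow> real vec set \<Rightarrow> bool" where
  "convex_vec d C \<longleftrightarrow> C \<subseteq> carrier_vec d \<and>
     (\<forall>x\<in>C. \<forall>y\<in>C. \<forall>s\<ge>0. \<forall>t\<ge>0. s + t = 1 \<longrightarrow> s \<cdot>\<^sub>v x + t \<cdot>\<^sub>v y \<in> C)"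

definition GL :: "nat \<Rightarrow> real mat monoid" where
  "GL d = units_of (ring_mat TYPE(real) d ())"

definition orbit_polytope ::
    "nat \<Rightarrow> ('g, 'm) monoid_scheme \<Rightarrow> ('g \<Rightarrow> real mat) \<Rightarrow> real vec \<Rightarrow> real vec set" where
  "orbit_polytope d G D v = convex_vec d hull ((\<lambda>g. D g *\<^sub>v v) ` carrier G)"

text \<open>
  As in \<open>Bij P\<close>, symmetries are extensional functions, so that two of them are equal if and only if
  they agree on \<open>P\<close>.
\<close>

definition affine_symmetries :: "nat \<Rightarrow> real vec set \<Rightarrow> (real vec \<Rightarrow> real vec) set" where
  "affine_symmetries d P = {f \<in> Bij P.
     \<exists>A\<in>carrier_mat d d. \<exists>b\<in>carrier_vec d. \<forall>x\<in>P. f x = A *\<^sub>v x + b}"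

definition affine_symmetry_group ::
    "nat \<Rightarrow> real vec set \<Rightarrow> (real vec \<Rightarrow> real vec) monoid" where
  "affine_symmetry_group d P = BijGroup P\<lparr>carrier := affine_symmetries d P\<rparr>"

definition natural_map ::
    "nat \<Rightarrow> ('g, 'm) monoid_scheme \<Rightarrow> ('g \<Rightarrow> real mat) \<Rightarrow> real vec \<Rightarrow> 'g \<Rightarrow> real vec \<Rightarrow> real vec" where
  "natural_map d G D v g = (\<lambda>x\<in>orbit_polytope d G D v. D g *\<^sub>v x)"

definition is_affine_symmetry_group_of_orbit_polytope :: "('g, 'm) monoid_scheme \<Rightarrow> bool" where
  "is_affine_symmetry_group_of_orbit_polytope G \<longleftrightarrow>
     (\<exists>d. \<exists>D\<in>hom G (GL d). \<exists>v\<in>carrier_vec d.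
        natural_map d G D v \<in> iso G (affine_symmetry_group d (orbit_polytope d G D v)))"

definition elementary_abelian :: "nat \<Rightarrow> ('g, 'm) monoid_scheme \<Rightarrow> bool" where
  "elementary_abelian p G \<longleftrightarrow> comm_group G \<and> (\<forall>x\<in>carrier G. x [^]\<^bsub>G\<^esub> p = \<one>\<^bsub>G\<^esub>)"

end

theory Submission
  imports Defs
begin

text \<open>
  Up to affine equivalence an orbit polytope of \<open>G\<close> is determined by the set \<open>S\<close> of nontrivial
  characters occurring in \<open>v\<close>: it is the convex hull of the points \<open>(\<chi> g)\<close>, \<open>\<chi> \<in> S\<close>. A permutation
  of \<open>G\<close> extends to an affine symmetry iff it preserves the span of \<open>S\<close> and the constants.

  For \<open>n \<in> {2, 3, 4}\<close> a count rules out every \<open>S\<close>. If no nontrivial automorphism of \<open>G\<close> stabilized \<open>S\<close>,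
  then \<open>S\<close> and its complement, whose sizes differ because \<open>2\<^sup>n - 1\<close> is odd, would have disjoint regular
  orbits among the subsets of the nontrivial characters, but \<open>2 |Aut G| > 2^(2^n - 1)\<close>.

  For \<open>n \<ge> 5\<close> it suffices that the Schur ring generated by \<open>S\<close> is everything. Indeed, let a
  permutation fix the identity and preserve the span of \<open>S\<close> and the constants. Its matrix in the
  basis of characters is orthogonal and compatible with products of functions, so it is block
  diagonal with respect to every set in that Schur ring. Hence it fixes every character. Such \<open>S\<close>
  exists for \<open>n = 5\<close>, and in the step from \<open>n\<close> to \<open>n + 1\<close> one adds a new character to \<open>S\<close> and
  takes the complement.
\<close>

unbundle bit_operations_syntax

section \<open>Schur relations on the cube\<close>

text \<open>With this operation the subsets of \<open>{..<n}\<close> form the elementary abelian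
  group of order \<open>2 ^ n\<close>. The same sets later serve as labels of its
  characters.\<close>

definition symd :: "nat set \<Rightarrow> nat set \<Rightarrow> nat set"  (infixl "\<triangle>" 65)
  where "A \<triangle> B = (A - B) \<union> (B - A)"

lemma symd_commute: "A \<triangle> B = B \<triangle> A"
  by (auto simp: symd_def)

lemma symd_assoc: "(A \<triangle> B) \<triangle> C = A \<triangle> (B \<triangle> C)"
  by (auto simp: symd_def)

lemma symd_left_commute: "A \<triangle> (B \<triangle> C) = B \<triangle> (A \<triangle> C)"
  by (auto simp: symd_def)

lemma symd_empty [simp]: "A \<triangle> {} = A" "{} \<triangle> A = A" "A \<triangle> A = {}"
  by (auto simp: symd_def)

lemma symd_cancel [simp]: "A \<triangle> (A \<triangle> B) = B" "B \<triangle> A \<triangle> A = B"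
  by (auto simp: symd_def)

lemma symd_eq_iff: "A \<triangle> B = C \<longleftrightarrow> A = B \<triangle> C"
  by (auto simp: symd_def)

lemma symd_eq_empty [simp]: "A \<triangle> B = {} \<longleftrightarrow> A = B"
  by (auto simp: symd_def)

lemma symd_subset: "A \<subseteq> X \<Longrightarrow> B \<subseteq> X \<Longrightarrow> A \<triangle> B \<subseteq> X"
  by (auto simp: symd_def)

abbreviation U :: "nat \<Rightarrow> nat set set" where "U n \<equiv> Pow {..<n}"

lemma symd_in_U: "A \<in> U n \<Longrightarrow> B \<in> U n \<Longrightarrow> A \<triangle> B \<in> U n"
  by (auto simp: symd_def)

lemma card_U [simp]: "card (U n) = 2 ^ n"
  by (simp add: card_Pow)

lemma bij_betw_symd: "A \<in> U n \<Longrightarrow> bij_betw (\<lambda>B. A \<triangle> B) (U n) (U n)"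
  by (rule bij_betw_byWitness[where f' = "\<lambda>B. A \<triangle> B"]) (auto simp: symd_def)

text \<open>\<open>S\<close> and its translate by \<open>A\<close> each fill more than half of the
  cube, so they meet.\<close>

lemma large_subset_triangle:
  assumes "S \<subseteq> U n" "2 ^ n < 2 * card S" "A \<in> U n"
  shows "\<exists>B\<in>S. A \<triangle> B \<in> S"
proof (rule ccontr)
  assume neg: "\<not> ?thesis"
  have "inj_on (\<lambda>B. A \<triangle> B) S"
    by (rule inj_onI) (metis symd_cancel(1))
  hence "card ((\<lambda>B. A \<triangle> B) ` S) = card S" by (rule card_image)
  moreover have "S \<inter> (\<lambda>B. A \<triangle> B) ` S = {}"
    using neg by (auto simp: symd_eq_iff)
  moreover have "finite S" using assms(1) by (rule finite_subset) simp
  ultimately have "card (S \<union> (\<lambda>B. A \<triangle> B) ` S) = 2 * card S"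
    by (simp add: card_Un_disjoint)
  moreover have "S \<union> (\<lambda>B. A \<triangle> B) ` S \<subseteq> U n" using assms(1,3) by (auto simp: symd_def)
  hence "card (S \<union> (\<lambda>B. A \<triangle> B) ` S) \<le> card (U n)"
    by (intro card_mono) auto
  ultimately show False using assms(2) by simp
qed

text \<open>\<open>R\<close> is a relation and not a partition because it will be instantiated by
  the nonvanishing of matrix entries. Membership predicates \<open>f\<close> give the sets respected
  by \<open>R\<close>; other \<open>f\<close> act as colourings.\<close>

definition invariant :: "nat \<Rightarrow> (nat set \<Rightarrow> nat set \<Rightarrow> bool) \<Rightarrow> (nat set \<Rightarrow> 'c) \<Rightarrow> bool" where
  "invariant n R f \<longleftrightarrow> (\<forall>A\<in>U n. \<forall>C\<in>U n. R A C \<longrightarrow> f A = f C)"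

text \<open>
  The sets respected by such a relation form a Schur ring over the cube: besides the Boolean
  operations, they are closed under taking level sets of convolutions of indicator functions.
\<close>

definition schur_rel :: "nat \<Rightarrow> (nat set \<Rightarrow> nat set \<Rightarrow> bool) \<Rightarrow> bool" where
  "schur_rel n R \<longleftrightarrow> invariant n R (\<lambda>A. A = {}) \<and>
     (\<forall>T T'. invariant n R (\<lambda>A. A \<in> T) \<longrightarrow> invariant n R (\<lambda>A. A \<in> T') \<longrightarrow>
        invariant n R (\<lambda>A. card {B \<in> U n. B \<in> T \<and> A \<triangle> B \<in> T'}))"

text \<open>The Schur ring generated by \<open>S\<close> contains all singletons, expressed without
  constructing that ring. A proof derives ever finer invariant colourings from
  \<open>S\<close>.\<close>

definition rigid :: "nat \<Rightarrow> nat set set \<Rightarrow> bool" where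
  "rigid n S \<longleftrightarrow> (\<forall>R. schur_rel n R \<longrightarrow> invariant n R (\<lambda>A. A \<in> S) \<longrightarrow> invariant n R (\<lambda>A. A))"

lemma invariant_comp:
  assumes "invariant n R f" "\<And>A. A \<in> U n \<Longrightarrow> g A = h (f A)"
  shows "invariant n R g"
  using assms by (auto simp: invariant_def)

lemma invariant_Pair:
  "invariant n R f \<Longrightarrow> invariant n R g \<Longrightarrow> invariant n R (\<lambda>A. (f A, g A))"
  by (auto simp: invariant_def)

lemma invariant_comp2:
  assumes "invariant n R f" "invariant n R g" "\<And>A. A \<in> U n \<Longrightarrow> k A = h (f A) (g A)"
  shows "invariant n R k"
  using assms by (auto simp: invariant_def)

lemma invariant_mono:
  assumes "invariant (Suc n) R f"
  shows "invariant n R f"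
proof -
  have "A \<in> U (Suc n)" if "A \<in> U n" for A using that by auto
  thus ?thesis using assms unfolding invariant_def by simp
qed

lemma invariant_count:
  assumes "schur_rel n R" "invariant n R (\<lambda>A. A \<in> T)" "T \<subseteq> U n"
  shows "invariant n R (\<lambda>A. card {B \<in> T. A \<triangle> B \<in> T})"
proof -
  have "{B \<in> U n. B \<in> T \<and> A \<triangle> B \<in> T} = {B \<in> T. A \<triangle> B \<in> T}" for A
    using assms(3) by auto
  moreover have "invariant n R (\<lambda>A. card {B \<in> U n. B \<in> T \<and> A \<triangle> B \<in> T})"
    using assms(1,2) unfolding schur_rel_def by blast
  ultimately show ?thesis by (simp only:)
qed

text \<open>Convolving the indicators of \<open>{a}\<close> and of a level set of \<open>f\<close>
  gives the indicator of the translated level set.\<close>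

lemma invariant_translate:
  assumes R: "schur_rel n R" and a: "invariant n R (\<lambda>A. A = a)" "a \<in> U n"
    and f: "invariant n R f"
  shows "invariant n R (\<lambda>A. f (A \<triangle> a))"
  unfolding invariant_def
proof (intro ballI impI)
  fix A C assume AC: "A \<in> U n" "C \<in> U n" "R A C"
  define T where "T = {B. f B = f (A \<triangle> a)}"
  have "invariant n R (\<lambda>B. B \<in> {a})" "invariant n R (\<lambda>B. B \<in> T)"
    using a f by (auto simp: T_def invariant_def)
  hence "card {B \<in> U n. B \<in> {a} \<and> A \<triangle> B \<in> T} = card {B \<in> U n. B \<in> {a} \<and> C \<triangle> B \<in> T}"
    using R AC unfolding schur_rel_def invariant_def by blast
  moreover have "{B \<in> U n. B \<in> {a} \<and> A \<triangle> B \<in> T} = {a}" using a by (auto simp: T_def)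
  ultimately have "{B \<in> U n. B \<in> {a} \<and> C \<triangle> B \<in> T} \<noteq> {}" by (metis card.empty card_1_singleton_iff insert_not_empty One_nat_def)
  thus "f (A \<triangle> a) = f (C \<triangle> a)" by (auto simp: T_def)
qed

lemma invariant_eq_symd:
  assumes "schur_rel n R" "invariant n R (\<lambda>A. A = a)" "a \<in> U n" "invariant n R (\<lambda>A. A = b)"
  shows "invariant n R (\<lambda>A. A = a \<triangle> b)"
proof -
  have "(\<lambda>A. A \<triangle> a = b) = (\<lambda>A. A = a \<triangle> b)" by (auto simp: symd_eq_iff)
  thus ?thesis using invariant_translate[OF assms] by simp
qed

lemma invariant_id_if:
  assumes "\<And>a. a \<in> U n \<Longrightarrow> invariant n R (\<lambda>A. A = a)"
  shows "invariant n R (\<lambda>A. A)"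
  using assms unfolding invariant_def by blast

text \<open>Invariant points are closed under sums, and the basis vectors generate the cube.\<close>

lemma invariant_id_if_singletons:
  assumes R: "schur_rel n R" and "\<And>i. i < n \<Longrightarrow> invariant n R (\<lambda>A. A = {i})"
  shows "invariant n R (\<lambda>A. A)"
proof (rule invariant_id_if)
  fix a assume a: "a \<in> U n"
  hence "finite a" by (auto intro: finite_subset)
  thus "invariant n R (\<lambda>A. A = a)" using a
  proof (induction a rule: finite_induct)
    case empty
    show ?case using R by (simp add: schur_rel_def)
  next
    case (insert i F)
    hence "insert i F = {i} \<triangle> F" by (auto simp: symd_def)
    thus ?case using invariant_eq_symd[OF R assms(2)[of i], of F] insert by auto
  qed
qed

text \<open>
  As \<open>S\<close> fills more than half of the cube, each of its elements is a sum of two others, but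
  \<open>{n}\<close> is not such a sum: this separates \<open>{n}\<close> from \<open>S\<close>. Passing to the complement
  keeps the density above one half.
\<close>

lemma rigid_Suc:
  assumes S: "S \<subseteq> U n" "{} \<notin> S" "2 ^ n < 2 * card S" and rig: "rigid n S"
  shows "rigid (Suc n) (U (Suc n) - insert {} (insert {n} S))"
  unfolding rigid_def
proof (intro allI impI)
  fix R assume R: "schur_rel (Suc n) R"
    and inv: "invariant (Suc n) R (\<lambda>A. A \<in> U (Suc n) - insert {} (insert {n} S))"
  define T where "T = insert {n} S"
  have sub: "U n \<subseteq> U (Suc n)" by auto
  have n: "{n} \<in> U (Suc n)" "{n} \<notin> U n" by auto
  have T: "T \<subseteq> U (Suc n)" using S sub n by (auto simp: T_def)
  have finT: "finite T" by (rule finite_subset[OF T]) simp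
  have finS: "finite S" using finT by (simp add: T_def)
  \<comment> \<open>Since \<open>{}\<close> is itself singled out, it does not disturb the passage
    from the given set to its complement.\<close>
  have invT: "invariant (Suc n) R (\<lambda>A. A \<in> T)"
    by (rule invariant_comp2[OF inv, of "\<lambda>A. A = {}" _ "\<lambda>p q. \<not> p \<and> \<not> q"])
      (use R S n in \<open>auto simp: schur_rel_def T_def\<close>)
  define c where "c = (\<lambda>A. card {B \<in> T. A \<triangle> B \<in> T})"
  have invc: "invariant (Suc n) R c"
    unfolding c_def by (rule invariant_count[OF R invT T])
  have cpos: "c A > 0 \<longleftrightarrow> (\<exists>B\<in>T. A \<triangle> B \<in> T)" for A
    using finT by (auto simp: c_def card_gt_0_iff)
  have "A \<in> S \<longleftrightarrow> A \<in> T \<and> 0 < c A" for A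
  proof
    assume "A \<in> S"
    thus "A \<in> T \<and> 0 < c A"
      using large_subset_triangle[OF S(1,3), of A] S(1) by (auto simp: cpos T_def)
  next
    assume *: "A \<in> T \<and> 0 < c A"
    \<comment> \<open>For \<open>B\<close> in \<open>S\<close>, the sum
      \<open>{n} \<triangle> B\<close> contains \<open>n\<close> and a further element, so it is not
      in \<open>T\<close>; for \<open>B = {n}\<close> the sum is \<open>{}\<close>.\<close>
    have "\<not> (0 < c {n})"
    proof
      assume "0 < c {n}"
      then obtain B where B: "B \<in> T" "{n} \<triangle> B \<in> T" by (auto simp: cpos)
      have "B \<noteq> {n}" using B S(2) by (auto simp: T_def)
      hence "B \<in> S" using B by (auto simp: T_def)
      hence "n \<notin> B" "B \<noteq> {}" using S by auto
      hence "n \<in> {n} \<triangle> B" "{n} \<triangle> B \<noteq> {n}" by (auto simp: symd_def)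
      thus False using B S(1) by (auto simp: T_def)
    qed
    thus "A \<in> S" using * by (auto simp: T_def)
  qed
  hence invS: "invariant (Suc n) R (\<lambda>A. A \<in> S)"
    by (intro invariant_comp2[OF invT invc, of _ "\<lambda>p q. p \<and> 0 < q"]) simp
  have invn: "invariant (Suc n) R (\<lambda>A. A = {n})"
    by (rule invariant_comp2[OF invT invS, of _ "\<lambda>p q. p \<and> \<not> q"]) (use S n in \<open>auto simp: T_def\<close>)
  have SU: "S \<subseteq> U (Suc n)" using S(1) sub by blast
  \<comment> \<open>By density the small cube is exactly the set of sums of two elements of
    \<open>S\<close>, so \<open>R\<close> respects it.\<close>
  have Uiff: "A \<in> U n \<longleftrightarrow> 0 < card {B \<in> S. A \<triangle> B \<in> S}" for A
  proof
    assume "A \<in> U n"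
    thus "0 < card {B \<in> S. A \<triangle> B \<in> S}"
      using large_subset_triangle[OF S(1,3), of A] finS by (auto simp: card_gt_0_iff)
  next
    assume "0 < card {B \<in> S. A \<triangle> B \<in> S}"
    then obtain B where "B \<in> S" "A \<triangle> B \<in> S" by (auto simp: card_gt_0_iff)
    hence "(A \<triangle> B) \<triangle> B \<in> U n" using S(1) symd_in_U[of "A \<triangle> B" n B] by (meson subsetD)
    thus "A \<in> U n" by simp
  qed
  have invU: "invariant (Suc n) R (\<lambda>A. A \<in> U n)"
    by (rule invariant_comp[OF invariant_count[OF R invS SU], of _ "\<lambda>k. 0 < k"]) (rule Uiff)
  \<comment> \<open>Sets respected inside the small cube, once intersected with \<open>U n\<close>,
    are respected in the large one. For \<open>A\<close> in \<open>U n\<close> the counts in both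
    cubes agree, as \<open>A \<triangle> B\<close> stays in \<open>U n\<close>.\<close>
  have "schur_rel n R"
    unfolding schur_rel_def
  proof (intro conjI allI impI)
    show "invariant n R (\<lambda>A. A = {})"
      using R by (simp add: schur_rel_def invariant_mono)
    fix T T' assume TT': "invariant n R (\<lambda>A. A \<in> T)" "invariant n R (\<lambda>A. A \<in> T')"
    have *: "invariant (Suc n) R (\<lambda>A. A \<in> X \<inter> U n)" if "invariant n R (\<lambda>A. A \<in> X)" for X
      using that invU unfolding invariant_def Int_iff by metis
    have "invariant (Suc n) R (\<lambda>A. card {B \<in> U (Suc n). B \<in> T \<inter> U n \<and> A \<triangle> B \<in> T' \<inter> U n})"
      using R *[OF TT'(1)] *[OF TT'(2)] unfolding schur_rel_def by blast
    hence "invariant n R (\<lambda>A. card {B \<in> U (Suc n). B \<in> T \<inter> U n \<and> A \<triangle> B \<in> T' \<inter> U n})"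
      by (rule invariant_mono)
    moreover have "{B \<in> U (Suc n). B \<in> T \<inter> U n \<and> A \<triangle> B \<in> T' \<inter> U n} = {B \<in> U n. B \<in> T \<and> A \<triangle> B \<in> T'}"
      if "A \<in> U n" for A
      using that sub symd_in_U[OF that] by blast
    ultimately show "invariant n R (\<lambda>A. card {B \<in> U n. B \<in> T \<and> A \<triangle> B \<in> T'})"
      by (elim invariant_comp[where h = "\<lambda>k. k"]) simp
  qed
  moreover have "invariant n R (\<lambda>A. A \<in> S)"
    using invS by (rule invariant_mono)
  ultimately have id: "invariant n R (\<lambda>A. A)"
    using rig by (auto simp: rigid_def)
  show "invariant (Suc n) R (\<lambda>A. A)"
  proof (rule invariant_id_if_singletons[OF R])
    fix i assume "i < Suc n"
    show "invariant (Suc n) R (\<lambda>A. A = {i})"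
    proof (cases "i = n")
      case True thus ?thesis using invn by simp
    next
      case False
      hence "{i} \<in> U n" using \<open>i < Suc n\<close> by auto
      thus ?thesis using invU id unfolding invariant_def by metis
    qed
  qed
qed

section \<open>Binary encoding of subsets and the rigid set in dimension 5\<close>

definition code_set :: "nat \<Rightarrow> nat set" where "code_set x = {i. bit x i}"

lemma code_set_xor: "code_set (x XOR y) = code_set x \<triangle> code_set y"
  by (auto simp: code_set_def symd_def bit_xor_iff)

lemma inj_code_set: "inj code_set"
  by (rule injI) (auto simp: code_set_def bit_eq_iff set_eq_iff)

lemma code_set_in_U: "x < 2 ^ n \<Longrightarrow> code_set x \<in> U n"
proof -
  assume "x < 2 ^ n"
  hence "take_bit n x = x" by (simp add: take_bit_nat_eq_self)
  hence "i < n" if "bit x i" for i using that bit_take_bit_iff[of n x i] by simp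
  thus ?thesis by (auto simp: code_set_def)
qed

lemma bij_code_set: "bij_betw code_set {..<2 ^ n} (U n)"
proof -
  have "inj_on code_set {..<2 ^ n}" using inj_code_set by (rule inj_on_subset) simp
  moreover have "code_set ` {..<2 ^ n} = U n"
    by (rule card_subset_eq)
       (use calculation code_set_in_U in \<open>auto simp: card_image simp del: Pow_iff\<close>)
  ultimately show ?thesis by (simp add: bij_betw_def)
qed


text \<open>
  A rigid set in dimension 5, found by computer search. Subsets of \<open>{..<5}\<close> are encoded in binary.
  The number of representations as a sum of two elements singles out 24 and 27 (hence their sum 3),
  and the colours of the translates by these three single out all basis vectors.
\<close>

definition base_codes :: "nat list" where
  "base_codes = [1, 2, 4, 8, 16, 24, 30, 6, 13, 7, 21, 20, 26]"

definition code_colour :: "nat \<Rightarrow> bool \<times> nat" where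
  "code_colour x = (x \<in> set base_codes, length (filter (\<lambda>y. x XOR y \<in> set base_codes) base_codes))"

text \<open>The values of \<open>code_colour\<close>, tabulated once so that the uniqueness checks
  are lookups.\<close>

definition base_colours :: "(bool \<times> nat) list" where
  "base_colours = [(False, 13), (True, 4), (True, 4), (False, 4), (True, 6), (False, 8), (True, 6),
     (True, 2), (True, 2), (False, 4), (False, 8), (False, 4), (False, 6), (True, 2), (False, 6),
     (False, 6), (True, 4), (False, 4), (False, 8), (False, 6), (True, 4), (True, 4), (False, 6),
     (False, 6), (True, 8), (False, 6), (True, 4), (False, 2), (False, 8), (False, 6), (True, 4),
     (False, 4)]"

lemma map_code_colour: "map code_colour [0..<32] = base_colours"
  by code_simp

lemma base_colours_unique:
  "list_all (\<lambda>x. (base_colours ! x = (True, 8)) = (x = 24) \<and> (base_colours ! x = (False, 2)) = (x = 27)) [0..<32]"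
  by code_simp

definition base_colours3 :: "nat \<Rightarrow> (bool \<times> nat) \<times> (bool \<times> nat) \<times> (bool \<times> nat)" where
  "base_colours3 x = (base_colours ! (x XOR 24), base_colours ! (x XOR 27), base_colours ! (x XOR 3))"

lemma base_colours3_unique:
  "list_all (\<lambda>y. list_all (\<lambda>x. (base_colours3 x = base_colours3 y) = (x = y)) [0..<32]) [1,2,4,8,16]"
  by code_simp

lemma code_set_lt_32_cases:
  assumes "A \<in> U 5" obtains x where "x < 32" "A = code_set x"
proof -
  have "A \<in> code_set ` {..<2 ^ 5}" using assms bij_code_set[of 5] by (simp only: bij_betw_def)
  thus thesis using that by auto
qed

lemma code_set_eq_iff [simp]: "code_set x = code_set y \<longleftrightarrow> x = y"
  using inj_code_set by (auto simp: inj_def)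

lemma code_set_power: "code_set (2 ^ i) = {i}"
  by (auto simp: code_set_def bit_exp_iff)

lemma card_base_translate:
  "card {B \<in> code_set ` set base_codes. code_set x \<triangle> B \<in> code_set ` set base_codes} =
     length (filter (\<lambda>y. x XOR y \<in> set base_codes) base_codes)"
proof -
  have "{B \<in> code_set ` set base_codes. code_set x \<triangle> B \<in> code_set ` set base_codes} =
    code_set ` set (filter (\<lambda>y. x XOR y \<in> set base_codes) base_codes)"
    by (auto simp flip: code_set_xor)
  also have "card \<dots> = card (set (filter (\<lambda>y. x XOR y \<in> set base_codes) base_codes))"
    using inj_code_set by (intro card_image) (auto simp: inj_on_def)
  also have "\<dots> = length (filter (\<lambda>y. x XOR y \<in> set base_codes) base_codes)"
    by (intro distinct_card distinct_filter) (simp add: base_codes_def)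
  finally show ?thesis .
qed

lemma rigid_base: "rigid 5 (code_set ` set base_codes)"
  unfolding rigid_def
proof (intro allI impI)
  fix R assume R: "schur_rel 5 R" and inv: "invariant 5 R (\<lambda>A. A \<in> code_set ` set base_codes)"
  define S where "S = code_set ` set base_codes"
  define col where "col = (\<lambda>A. (A \<in> S, card {B \<in> S. A \<triangle> B \<in> S}))"
  have SU: "S \<subseteq> U 5"
    unfolding S_def by (intro image_subsetI code_set_in_U) (auto simp: base_codes_def)
  have invcol: "invariant 5 R col"
    unfolding col_def using inv invariant_count[OF R inv[folded S_def] SU]
    by (intro invariant_Pair) (auto simp: S_def)
  have col: "col (code_set x) = base_colours ! x" if "x < 32" for x
  proof -
    have "col (code_set x) = code_colour x"
      by (auto simp: col_def code_colour_def S_def card_base_translate)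
    also have "\<dots> = map code_colour [0..<32] ! x" using that by simp
    finally show ?thesis by (simp only: map_code_colour)
  qed
  have single: "invariant 5 R (\<lambda>A. A = code_set a)"
    if "invariant 5 R f" "\<And>x. x < 32 \<Longrightarrow> f (code_set x) = f (code_set a) \<longleftrightarrow> x = a" for a f
    by (rule invariant_comp[OF that(1), of _ "\<lambda>c. c = f (code_set a)"])
      (use that(2) code_set_lt_32_cases in \<open>metis code_set_eq_iff\<close>)
  have uniq: "base_colours ! x = (True, 8) \<longleftrightarrow> x = 24" "base_colours ! x = (False, 2) \<longleftrightarrow> x = 27"
    if "x < 32" for x
    using base_colours_unique that by (auto simp only: list_all_iff set_upt atLeastLessThan_iff)
  have 24: "invariant 5 R (\<lambda>A. A = code_set 24)"
    by (rule single[OF invcol]) (simp add: col uniq iffD2[OF uniq(1)[of 24]])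
  have 27: "invariant 5 R (\<lambda>A. A = code_set 27)"
    by (rule single[OF invcol]) (simp add: col uniq iffD2[OF uniq(2)[of 27]])
  have U: "code_set 24 \<in> U 5" "code_set 27 \<in> U 5" "code_set 3 \<in> U 5"
    by (rule code_set_in_U; simp)+
  have "code_set 24 \<triangle> code_set 27 = code_set 3" by (simp flip: code_set_xor)
  hence 3: "invariant 5 R (\<lambda>A. A = code_set 3)"
    using invariant_eq_symd[OF R 24 U(1) 27] by simp
  \<comment> \<open>The colours alone do not separate the basis vectors: 1 and 2 share the colour
    \<open>(True, 4)\<close>. The colours of their translates by the three known points do.\<close>
  define pat where "pat = (\<lambda>A. (col (A \<triangle> code_set 24), col (A \<triangle> code_set 27), col (A \<triangle> code_set 3)))"
  have invpat: "invariant 5 R pat"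
    unfolding pat_def
    by (intro invariant_Pair invariant_translate[OF R _ _ invcol] 24 27 3 U)
  have pat: "pat (code_set x) = base_colours3 x" if "x < 32" for x
  proof -
    have "x XOR y < 32" if "y < 32" for y :: nat
    proof -
      have "take_bit 5 (x XOR y) = x XOR y"
        using that \<open>x < 32\<close> by (simp add: take_bit_xor take_bit_nat_eq_self)
      thus ?thesis using take_bit_nat_less_exp[of 5 "x XOR y"] by simp
    qed
    thus ?thesis by (simp add: pat_def base_colours3_def col flip: code_set_xor)
  qed
  have pow: "invariant 5 R (\<lambda>A. A = code_set y)" if "y \<in> set [1,2,4,8,16]" for y
  proof (rule single[OF invpat])
    fix x :: nat assume x: "x < 32"
    have "y < 32" using that by auto
    moreover have "x \<in> {0..<32}" using x by simp
    hence "(base_colours3 x = base_colours3 y) = (x = y)"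
      using base_colours3_unique that unfolding list_all_iff set_upt by blast
    ultimately show "pat (code_set x) = pat (code_set y) \<longleftrightarrow> x = y"
      using x by (simp only: pat)
  qed
  show "invariant 5 R (\<lambda>A. A)"
  proof (rule invariant_id_if_singletons[OF R])
    fix i :: nat assume "i < 5"
    hence "i \<in> {0,1,2,3,4}" by auto
    hence "2 ^ i \<in> set [1,2,4,8,16::nat]" by auto
    from pow[OF this] show "invariant 5 R (\<lambda>A. A = {i})" by (simp only: code_set_power)
  qed
qed

text \<open>The base set has only 13 of the 32 elements, too few for
  \<open>large_subset_triangle\<close>; this replaces it by a set of 18.\<close>

lemma rigid_compl:
  assumes "rigid n S" "T = U n - insert {} S" "{} \<notin> S"
  shows "rigid n T"
  unfolding rigid_def
proof (intro allI impI)
  fix R assume R: "schur_rel n R" and T: "invariant n R (\<lambda>A. A \<in> T)"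
  have "invariant n R (\<lambda>A. A \<in> S)"
    by (rule invariant_comp2[OF T, of "\<lambda>A. A = {}" _ "\<lambda>p q. \<not> p \<and> \<not> q"])
      (use R assms(2,3) in \<open>auto simp: schur_rel_def\<close>)
  thus "invariant n R (\<lambda>A. A)" using assms(1) R by (auto simp: rigid_def)
qed

lemma ex_rigid_5:
  "\<exists>S. S \<subseteq> U 5 \<and> {} \<notin> S \<and> 2 ^ 5 < 2 * card S \<and> card S + 2 < 2 ^ 5 \<and> rigid 5 S"
proof -
  let ?B = "code_set ` set base_codes"
  have z: "code_set 0 = {}" by (auto simp: code_set_def)
  have ne: "{} \<notin> ?B" unfolding z[symmetric] by (auto simp: base_codes_def)
  have sub: "insert {} ?B \<subseteq> U 5"
    unfolding z[symmetric] image_insert[symmetric]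
    by (intro image_subsetI code_set_in_U) (auto simp: base_codes_def)
  have "card ?B = card (set base_codes)"
    using inj_code_set by (intro card_image) (auto simp: inj_on_def)
  also have "\<dots> = 13" by (subst distinct_card) (auto simp: base_codes_def)
  finally have "card (U 5 - insert {} ?B) = 18"
    using ne sub by (subst card_Diff_subset) auto
  thus ?thesis using rigid_compl[OF rigid_base refl ne]
    by (intro exI[of _ "U 5 - insert {} ?B"]) auto
qed

text \<open>The upper bound on \<open>card S\<close> keeps the induction going: the next set has
  \<open>2 ^ Suc n - (card S + 2)\<close> elements, which is more than half of the larger cube
  exactly when \<open>card S + 2 < 2 ^ n\<close>. The new upper bound follows from
  \<open>card S > 0\<close>.\<close>

lemma ex_rigid:
  assumes "n \<ge> 5"
  shows "\<exists>S. S \<subseteq> U n \<and> {} \<notin> S \<and> 2 ^ n < 2 * card S \<and> card S + 2 < 2 ^ n \<and> rigid n S"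
  using assms
proof (induction n rule: dec_induct)
  case base
  show ?case by (rule ex_rigid_5)
next
  case (step n)
  then obtain S where S: "S \<subseteq> U n" "{} \<notin> S" "2 ^ n < 2 * card S" "card S + 2 < 2 ^ n" "rigid n S"
    by blast
  let ?T = "U (Suc n) - insert {} (insert {n} S)"
  have sub: "insert {} (insert {n} S) \<subseteq> U (Suc n)" using S(1) by force
  have "finite S" using S(1) by (rule finite_subset) simp
  moreover have "{n} \<notin> S" using S(1) by auto
  ultimately have "card (insert {} (insert {n} S)) = card S + 2" using S(2) by simp
  hence "card ?T = 2 ^ Suc n - (card S + 2)"
    using sub by (subst card_Diff_subset) (auto intro: finite_subset)
  moreover have "card S > 0" using S(3) by (cases "card S") auto
  ultimately show ?case using S rigid_Suc[OF S(1,2,3,5)]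
    by (intro exI[of _ ?T]) auto
qed

section \<open>Characters and Fourier coefficients\<close>

text \<open>The characters of the cube. The symmetry in \<open>A\<close> and \<open>X\<close>
  identifies the group with its dual.\<close>

definition chi :: "nat set \<Rightarrow> nat set \<Rightarrow> real" where
  "chi A X = (-1) ^ card (A \<inter> X)"

lemma chi_commute: "chi A X = chi X A"
  by (simp add: chi_def Int_commute)

lemma chi_empty [simp]: "chi {} X = 1" "chi A {} = 1"
  by (simp_all add: chi_def)

lemma chi_singleton: "chi {i} X = (if i \<in> X then -1 else 1)"
  by (auto simp: chi_def)

lemma chi_cases: "chi A X = 1 \<or> chi A X = -1"
  by (metis chi_def neg_one_even_power neg_one_odd_power)

lemma chi_square [simp]: "chi A X * chi A X = 1"
  using chi_cases[of A X] by auto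

lemma chi_power2 [simp]: "(chi A X)\<^sup>2 = 1"
  by (simp add: power2_eq_square)

text \<open>In product form, multiplicativity in \<open>A\<close> can be checked factor by
  factor.\<close>

lemma chi_eq_prod:
  assumes "finite X"
  shows "chi A X = (\<Prod>i\<in>X. if i \<in> A then -1 else 1)"
proof -
  have "(\<Prod>i\<in>X. if i \<in> A then - 1 else (1::real)) = (\<Prod>i\<in>A \<inter> X. -1)"
    using assms by (intro prod.mono_neutral_cong_right) auto
  thus ?thesis by (simp add: chi_def)
qed

lemma finite_U: "X \<in> U n \<Longrightarrow> finite X"
  by (auto intro: finite_subset)

lemma empty_in_U: "{} \<in> U n" by simp

lemma chi_symd_left:
  assumes "X \<in> U n"
  shows "chi (A \<triangle> B) X = chi A X * chi B X"
  using finite_U[OF assms]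
  by (simp add: chi_eq_prod prod.distrib[symmetric]) (intro prod.cong, auto simp: symd_def)

lemma chi_symd_right:
  assumes "A \<in> U n"
  shows "chi A (X \<triangle> Y) = chi A X * chi A Y"
  using chi_symd_left[OF assms] by (simp add: chi_commute)

text \<open>For \<open>i\<close> in \<open>A\<close>, translating the summation variable by
  \<open>{i}\<close> changes the sign of every term.\<close>

lemma sum_chi:
  assumes "A \<in> U n"
  shows "(\<Sum>X\<in>U n. chi A X) = (if A = {} then 2 ^ n else 0)"
proof (cases "A = {}")
  case True
  thus ?thesis using card_U[of n] by simp
next
  case False
  then obtain i where i: "i \<in> A" by auto
  hence iU: "{i} \<in> U n" using assms by auto
  have "(\<Sum>X\<in>U n. chi A X) = (\<Sum>X\<in>U n. chi A ({i} \<triangle> X))"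
    by (rule sum.reindex_bij_betw[OF bij_betw_symd[OF iU], symmetric])
  also have "\<dots> = (\<Sum>X\<in>U n. - chi A X)"
    using i by (intro sum.cong refl) (simp add: chi_symd_right[OF assms] chi_commute[of A "{i}"] chi_singleton)
  finally show ?thesis using False by (simp add: sum_negf)
qed

lemma chi_orthogonal:
  assumes "A \<in> U n" "B \<in> U n"
  shows "(\<Sum>X\<in>U n. chi A X * chi B X) = (if A = B then 2 ^ n else 0)"
proof -
  have "(\<Sum>X\<in>U n. chi A X * chi B X) = (\<Sum>X\<in>U n. chi (A \<triangle> B) X)"
    by (intro sum.cong refl) (simp only: chi_symd_left)
  thus ?thesis using sum_chi[OF symd_in_U[OF assms]] by simp
qed

definition fourier :: "nat \<Rightarrow> (nat set \<Rightarrow> real) \<Rightarrow> nat set \<Rightarrow> real" where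
  "fourier n f C = (\<Sum>X\<in>U n. f X * chi C X) / 2 ^ n"

lemma fourier_inversion:
  assumes "X \<in> U n"
  shows "(\<Sum>C\<in>U n. fourier n f C * chi C X) = f X"
proof -
  have "(\<Sum>C\<in>U n. fourier n f C * chi C X) = (\<Sum>C\<in>U n. \<Sum>Y\<in>U n. f Y * (chi Y C * chi X C) / 2 ^ n)"
    by (simp add: fourier_def sum_divide_distrib sum_distrib_left sum_distrib_right chi_commute mult_ac)
  also have "\<dots> = (\<Sum>Y\<in>U n. \<Sum>C\<in>U n. f Y * (chi Y C * chi X C) / 2 ^ n)"
    by (rule sum.swap)
  also have "\<dots> = (\<Sum>Y\<in>U n. f Y * (\<Sum>C\<in>U n. chi Y C * chi X C) / 2 ^ n)"
    by (simp add: sum_divide_distrib sum_distrib_left)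
  also have "\<dots> = (\<Sum>Y\<in>U n. if Y = X then f X else 0)"
    by (intro sum.cong refl) (simp add: chi_orthogonal[OF _ assms] del: Pow_iff)
  finally show ?thesis using assms by simp
qed

lemma fourier_cong: "(\<And>X. X \<in> U n \<Longrightarrow> f X = g X) \<Longrightarrow> fourier n f C = fourier n g C"
  by (simp add: fourier_def del: Pow_iff cong: sum.cong)

text \<open>Used to turn membership in the span of the characters in \<open>T\<close> into the
  vanishing of all coefficients outside \<open>T\<close>.\<close>

lemma fourier_unique:
  assumes "T \<subseteq> U n" "C \<in> U n" "\<And>X. X \<in> U n \<Longrightarrow> f X = (\<Sum>B\<in>T. c B * chi B X)"
  shows "fourier n f C = (if C \<in> T then c C else 0)"
proof -
  have fin: "finite T" by (rule finite_subset[OF assms(1)]) simp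
  have "(\<Sum>X\<in>U n. f X * chi C X) = (\<Sum>X\<in>U n. \<Sum>B\<in>T. c B * (chi B X * chi C X))"
    using assms(3) by (intro sum.cong refl) (simp add: sum_distrib_right mult.assoc del: Pow_iff)
  also have "\<dots> = (\<Sum>B\<in>T. \<Sum>X\<in>U n. c B * (chi B X * chi C X))"
    by (rule sum.swap)
  also have "\<dots> = (\<Sum>B\<in>T. c B * (if B = C then 2 ^ n else 0))"
    using assms(1) by (intro sum.cong refl)
      (simp add: sum_distrib_left[symmetric] chi_orthogonal[OF _ assms(2)] subset_iff del: Pow_iff)
  also have "\<dots> = (if C \<in> T then c C * 2 ^ n else 0)"
    using fin by (simp add: if_distrib[of "(*) _"] sum.delta cong: if_cong)
  finally show ?thesis by (simp add: fourier_def)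
qed

lemma parseval: "(\<Sum>C\<in>U n. (fourier n f C)\<^sup>2) = (\<Sum>X\<in>U n. (f X)\<^sup>2) / 2 ^ n"
proof -
  have "(\<Sum>C\<in>U n. (fourier n f C)\<^sup>2) = (\<Sum>C\<in>U n. \<Sum>X\<in>U n. f X * (fourier n f C * chi C X) / 2 ^ n)"
    unfolding power2_eq_square
    by (subst (2) fourier_def) (simp add: sum_distrib_left sum_divide_distrib mult_ac)
  also have "\<dots> = (\<Sum>X\<in>U n. \<Sum>C\<in>U n. f X * (fourier n f C * chi C X) / 2 ^ n)"
    by (rule sum.swap)
  also have "\<dots> = (\<Sum>X\<in>U n. f X * (\<Sum>C\<in>U n. fourier n f C * chi C X) / 2 ^ n)"
    by (simp add: sum_divide_distrib sum_distrib_left)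
  also have "\<dots> = (\<Sum>X\<in>U n. f X * f X / 2 ^ n)"
    by (intro sum.cong refl) (simp only: fourier_inversion)
  finally show ?thesis by (simp add: sum_divide_distrib power2_eq_square)
qed

text \<open>Characters multiply by adding their labels, so pointwise products become convolutions of
  coefficients.\<close>

lemma fourier_mult:
  assumes "C \<in> U n"
  shows "fourier n (\<lambda>X. f X * g X) C = (\<Sum>E\<in>U n. fourier n f E * fourier n g (C \<triangle> E))"
proof -
  have "fourier n (\<lambda>X. f X * g X) C = (\<Sum>X\<in>U n. (\<Sum>E\<in>U n. fourier n f E * chi E X) * g X * chi C X) / 2 ^ n"
    unfolding fourier_def[of _ _ C] by (intro arg_cong2[where f = "(/)"] sum.cong refl) (simp only: fourier_inversion)
  also have "\<dots> = (\<Sum>X\<in>U n. \<Sum>E\<in>U n. fourier n f E * (g X * (chi C X * chi E X)) / 2 ^ n)"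
    by (simp add: sum_distrib_left sum_distrib_right sum_divide_distrib mult_ac)
  also have "\<dots> = (\<Sum>E\<in>U n. \<Sum>X\<in>U n. fourier n f E * (g X * (chi C X * chi E X)) / 2 ^ n)"
    by (rule sum.swap)
  also have "\<dots> = (\<Sum>E\<in>U n. fourier n f E * (\<Sum>X\<in>U n. g X * (chi C X * chi E X)) / 2 ^ n)"
    by (simp add: sum_divide_distrib sum_distrib_left)
  also have "\<dots> = (\<Sum>E\<in>U n. fourier n f E * fourier n g (C \<triangle> E))"
    unfolding fourier_def[of _ g] times_divide_eq_right
    by (intro arg_cong2[where f = "(/)"] arg_cong2[where f = "(*)"] sum.cong refl) (simp only: chi_symd_left)
  finally show ?thesis .
qed

section \<open>The matrix of a permutation in the basis of characters\<close>

locale cube_perm =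
  fixes n :: nat and p :: "nat set \<Rightarrow> nat set"
  assumes bij: "bij_betw p (U n) (U n)" and p_empty: "p {} = {}"
begin

definition q :: "nat set \<Rightarrow> nat set" where "q = the_inv_into (U n) p"

lemma q_p: "X \<in> U n \<Longrightarrow> q (p X) = X"
  unfolding q_def using bij by (intro the_inv_into_f_f) (auto simp: bij_betw_def)

text \<open>The matrix of composition with \<open>p\<close> in the basis of characters: row
  \<open>A\<close> expands the function obtained from \<open>chi A\<close>.\<close>

definition m :: "nat set \<Rightarrow> nat set \<Rightarrow> real" where
  "m A C = fourier n (\<lambda>X. chi A (p X)) C"

lemma m_dual: "m A C = fourier n (\<lambda>Y. chi C (q Y)) A"
proof -
  have "(\<Sum>X\<in>U n. chi A (p X) * chi C X) = (\<Sum>X\<in>U n. chi C (q (p X)) * chi A (p X))"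
    by (intro sum.cong refl) (simp add: q_p mult.commute del: Pow_iff)
  also have "\<dots> = (\<Sum>Y\<in>U n. chi C (q Y) * chi A Y)"
    by (rule sum.reindex_bij_betw[OF bij])
  finally show ?thesis by (simp add: m_def fourier_def)
qed

lemma p_in_U: "X \<in> U n \<Longrightarrow> p X \<in> U n"
  using bij by (auto simp: bij_betw_def simp del: Pow_iff)

lemma q_in_U: "Y \<in> U n \<Longrightarrow> q Y \<in> U n"
  using bij q_p by (metis bij_betw_imp_surj_on imageE)

lemma sum_row_squares: "(\<Sum>C\<in>U n. (m A C)\<^sup>2) = 1"
  using card_U[of n] by (simp add: m_def parseval del: Pow_iff)

lemma sum_column_squares: "(\<Sum>A\<in>U n. (m A C)\<^sup>2) = 1"
  using card_U[of n] by (simp add: m_dual parseval del: Pow_iff)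

text \<open>Composition with \<open>p\<close> respects products of functions, and products become
  convolutions.\<close>

lemma m_symd_left:
  assumes "C \<in> U n"
  shows "m (A \<triangle> B) C = (\<Sum>E\<in>U n. m A E * m B (C \<triangle> E))"
proof -
  have "m (A \<triangle> B) C = fourier n (\<lambda>X. chi A (p X) * chi B (p X)) C"
    unfolding m_def by (rule fourier_cong) (simp only: chi_symd_left[OF p_in_U])
  thus ?thesis by (simp add: fourier_mult[OF assms] m_def)
qed

lemma m_symd_right:
  assumes "A \<in> U n"
  shows "m A (C \<triangle> D) = (\<Sum>B\<in>U n. m B C * m (A \<triangle> B) D)"
proof -
  have "m A (C \<triangle> D) = fourier n (\<lambda>X. chi C (q X) * chi D (q X)) A"
    unfolding m_dual by (rule fourier_cong) (simp only: chi_symd_left[OF q_in_U])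
  thus ?thesis by (simp add: fourier_mult[OF assms] m_dual)
qed

lemma fourier_one: "C \<in> U n \<Longrightarrow> fourier n (\<lambda>X. 1) C = (if C = {} then 1 else 0)"
  by (simp add: fourier_def sum_chi del: Pow_iff)

lemma m_empty_left: "C \<in> U n \<Longrightarrow> m {} C = (if C = {} then 1 else 0)"
  by (simp add: m_def fourier_one del: Pow_iff)

lemma m_empty_right: "A \<in> U n \<Longrightarrow> m A {} = (if A = {} then 1 else 0)"
  by (simp add: m_dual fourier_one del: Pow_iff)

text \<open>The entry \<open>m A C\<close> can be expanded over \<open>E\<close> for each fixed
  \<open>B\<close>, and over \<open>B\<close> for each fixed \<open>E\<close>, with the same terms
  \<open>m B E * m (A \<triangle> B) (C \<triangle> E)\<close>. Where such a term is nonzero, the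
  conditions on \<open>B\<close> and \<open>A \<triangle> B\<close> are equivalent to those on
  \<open>E\<close> and \<open>C \<triangle> E\<close>. Double counting then gives
  \<open>k A * m A C = k C * m A C\<close>.\<close>

lemma schur_rel_m: "schur_rel n (\<lambda>A C. m A C \<noteq> 0)"
  unfolding schur_rel_def
proof (intro conjI allI impI)
  show "invariant n (\<lambda>A C. m A C \<noteq> 0) (\<lambda>A. A = {})"
    unfolding invariant_def using m_empty_left m_empty_right by metis
next
  fix T T' assume T: "invariant n (\<lambda>A C. m A C \<noteq> 0) (\<lambda>A. A \<in> T)" "invariant n (\<lambda>A C. m A C \<noteq> 0) (\<lambda>A. A \<in> T')"
  define k where "k = (\<lambda>A. card {B \<in> U n. B \<in> T \<and> A \<triangle> B \<in> T'})"
  have k: "real (k A) = (\<Sum>B\<in>U n. of_bool (B \<in> T) * of_bool (A \<triangle> B \<in> T'))" for A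
  proof -
    have "real (k A) = (\<Sum>B\<in>{B \<in> U n. B \<in> T \<and> A \<triangle> B \<in> T'}. 1)" by (simp add: k_def)
    also have "\<dots> = (\<Sum>B\<in>U n. of_bool (B \<in> T) * of_bool (A \<triangle> B \<in> T'))"
      by (rule sum.mono_neutral_cong_left) auto
    finally show ?thesis .
  qed
  have "k A = k C" if AC: "A \<in> U n" "C \<in> U n" "m A C \<noteq> 0" for A C
  proof -
    have split: "m A C = (\<Sum>E\<in>U n. m B E * m (A \<triangle> B) (C \<triangle> E))" for B
      using m_symd_left[OF AC(2), of B "A \<triangle> B"] by (simp add: symd_left_commute del: Pow_iff)
    have split': "m A C = (\<Sum>B\<in>U n. m B E * m (A \<triangle> B) (C \<triangle> E))" for E
      using m_symd_right[OF AC(1), of E "C \<triangle> E"] by (simp add: symd_left_commute del: Pow_iff)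
    have "real (k A) * m A C = (\<Sum>B\<in>U n. (of_bool (B \<in> T) * of_bool (A \<triangle> B \<in> T')) * m A C)"
      unfolding k by (rule sum_distrib_right)
    also have "\<dots> = (\<Sum>B\<in>U n. \<Sum>E\<in>U n.
        of_bool (B \<in> T) * of_bool (A \<triangle> B \<in> T') * (m B E * m (A \<triangle> B) (C \<triangle> E)))"
      by (intro sum.cong refl, subst split) (rule sum_distrib_left)
    also have "\<dots> = (\<Sum>B\<in>U n. \<Sum>E\<in>U n.
        of_bool (E \<in> T) * of_bool (C \<triangle> E \<in> T') * (m B E * m (A \<triangle> B) (C \<triangle> E)))"
    proof (intro sum.cong refl)
      fix B E assume BE: "B \<in> U n" "E \<in> U n"
      have "(B \<in> T) = (E \<in> T)" if "m B E \<noteq> 0"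
        using T(1) BE that unfolding invariant_def by blast
      moreover have "(A \<triangle> B \<in> T') = (C \<triangle> E \<in> T')" if "m (A \<triangle> B) (C \<triangle> E) \<noteq> 0"
        using T(2) symd_in_U[OF AC(1) BE(1)] symd_in_U[OF AC(2) BE(2)] that unfolding invariant_def by blast
      ultimately show "of_bool (B \<in> T) * of_bool (A \<triangle> B \<in> T') * (m B E * m (A \<triangle> B) (C \<triangle> E)) =
          of_bool (E \<in> T) * of_bool (C \<triangle> E \<in> T') * (m B E * m (A \<triangle> B) (C \<triangle> E))"
        by (cases "m B E = 0 \<or> m (A \<triangle> B) (C \<triangle> E) = 0") auto
    qed
    also have "\<dots> = (\<Sum>E\<in>U n. \<Sum>B\<in>U n.
        of_bool (E \<in> T) * of_bool (C \<triangle> E \<in> T') * (m B E * m (A \<triangle> B) (C \<triangle> E)))"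
      by (rule sum.swap)
    also have "\<dots> = (\<Sum>E\<in>U n. (of_bool (E \<in> T) * of_bool (C \<triangle> E \<in> T')) * m A C)"
      by (intro sum.cong refl, subst split') (rule sum_distrib_left[symmetric])
    also have "\<dots> = real (k C) * m A C"
      unfolding k by (rule sum_distrib_right[symmetric])
    finally show ?thesis using AC(3) by simp
  qed
  thus "invariant n (\<lambda>A C. m A C \<noteq> 0) (\<lambda>A. card {B \<in> U n. B \<in> T \<and> A \<triangle> B \<in> T'})"
    unfolding invariant_def k_def by blast
qed

text \<open>
  The matrix \<open>m\<close> is orthogonal, so a vanishing block forces the transposed block to vanish by
  comparing sums of squares.
\<close>

lemma invariant_m_if_rows:
  assumes T: "T \<subseteq> U n" and rows: "\<And>A B. A \<in> T \<Longrightarrow> B \<in> U n - T \<Longrightarrow> m A B = 0"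
  shows "invariant n (\<lambda>A C. m A C \<noteq> 0) (\<lambda>A. A \<in> T)"
proof -
  \<comment> \<open>The columns in \<open>T\<close> have total square sum \<open>card T\<close>. The
    block inside \<open>T\<close> already accounts for all of it, because the rows in
    \<open>T\<close> vanish outside that block.\<close>
  have "(\<Sum>B\<in>T. \<Sum>A\<in>U n. (m A B)\<^sup>2) = (\<Sum>B\<in>T. \<Sum>A\<in>U n - T. (m A B)\<^sup>2) + (\<Sum>B\<in>T. \<Sum>A\<in>T. (m A B)\<^sup>2)"
    using T by (simp add: sum.subset_diff[of T "U n"] sum.distrib)
  also have "(\<Sum>B\<in>T. \<Sum>A\<in>T. (m A B)\<^sup>2) = (\<Sum>A\<in>T. \<Sum>B\<in>T. (m A B)\<^sup>2)"
    by (rule sum.swap)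
  also have "\<dots> = (\<Sum>A\<in>T. \<Sum>B\<in>U n. (m A B)\<^sup>2)"
    using T rows by (intro sum.cong refl sum.mono_neutral_left) (auto simp del: Pow_iff)
  finally have "(\<Sum>B\<in>T. \<Sum>A\<in>U n - T. (m A B)\<^sup>2) = 0"
    by (simp add: sum_row_squares sum_column_squares)
  moreover have fin: "finite T" by (rule finite_subset[OF T]) simp
  ultimately have "(\<Sum>A\<in>U n - T. (m A B)\<^sup>2) = 0" if "B \<in> T" for B
    using that by (subst (asm) sum_nonneg_eq_0_iff) (auto intro: sum_nonneg)
  hence "m A B = 0" if "B \<in> T" "A \<in> U n - T" for A B
    using that by (subst (asm) sum_nonneg_eq_0_iff) auto
  thus ?thesis using rows unfolding invariant_def by blast
qed

text \<open>By \<open>aff\<close> the rows labelled by \<open>insert {} S\<close> vanish outside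
  that set. Hence the relation of nonvanishing entries respects \<open>S\<close>, and rigidity makes
  \<open>m\<close> diagonal.\<close>

lemma eq_id_if_rigid:
  assumes "rigid n S" "S \<subseteq> U n" "{} \<notin> S"
    and aff: "\<And>A. A \<in> S \<Longrightarrow> \<exists>b c. \<forall>X\<in>U n. chi A (p X) = b + (\<Sum>B\<in>S. c B * chi B X)"
    and X: "X \<in> U n"
  shows "p X = X"
proof -
  let ?T = "insert {} S"
  have fin: "finite S" by (rule finite_subset[OF assms(2)]) simp
  have T: "?T \<subseteq> U n" using assms(2) by simp
  have invT: "invariant n (\<lambda>A C. m A C \<noteq> 0) (\<lambda>A. A \<in> ?T)"
  proof (rule invariant_m_if_rows[OF T])
    fix A B assume AB: "A \<in> ?T" "B \<in> U n - ?T"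
    show "m A B = 0"
    proof (cases "A = {}")
      case True
      thus ?thesis using AB by (simp add: m_empty_left)
    next
      case False
      then obtain b c where bc: "\<forall>X\<in>U n. chi A (p X) = b + (\<Sum>B\<in>S. c B * chi B X)"
        using aff AB by blast
      have "chi A (p X) = (\<Sum>B\<in>?T. (c({} := b)) B * chi B X)" if "X \<in> U n" for X
      proof -
        have "(\<Sum>B\<in>?T. (c({} := b)) B * chi B X) = b + (\<Sum>B\<in>S. (c({} := b)) B * chi B X)"
          using fin assms(3) by simp
        also have "(\<Sum>B\<in>S. (c({} := b)) B * chi B X) = (\<Sum>B\<in>S. c B * chi B X)"
          using assms(3) by (intro sum.cong refl) auto
        finally show ?thesis using bc that by simp
      qed
      from fourier_unique[OF T _ this, of B] AB show ?thesis by (simp add: m_def)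
    qed
  qed
  have "invariant n (\<lambda>A C. m A C \<noteq> 0) (\<lambda>A. A = {})"
    using schur_rel_m by (simp add: schur_rel_def)
  from invariant_comp2[OF invT this, of "\<lambda>A. A \<in> S" "\<lambda>p q. p \<and> \<not> q"]
  have "invariant n (\<lambda>A C. m A C \<noteq> 0) (\<lambda>A. A \<in> S)" using assms(3) by auto
  hence "invariant n (\<lambda>A C. m A C \<noteq> 0) (\<lambda>A. A)"
    using assms(1) schur_rel_m by (auto simp: rigid_def)
  hence diag: "m A C = 0" if "A \<in> U n" "C \<in> U n" "A \<noteq> C" for A C
    using that unfolding invariant_def by blast
  have chi: "chi A (p Y) = m A A * chi A Y" if "A \<in> U n" "Y \<in> U n" for A Y
  proof -
    have "chi A (p Y) = (\<Sum>C\<in>U n. m A C * chi C Y)"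
      unfolding m_def by (rule fourier_inversion[OF that(2), symmetric])
    also have "\<dots> = (\<Sum>C\<in>{A}. m A C * chi C Y)"
      using that diag by (intro sum.mono_neutral_right) auto
    finally show ?thesis by simp
  qed
  \<comment> \<open>Evaluating at the fixed point \<open>{}\<close> shows \<open>m A A = 1\<close>.
    The characters \<open>chi {i}\<close> then recover the elements of \<open>p X\<close>.\<close>
  have "chi A (p X) = chi A X" if "A \<in> U n" for A
    using chi[OF that empty_in_U] chi[OF that X] p_empty by simp
  hence "i \<in> p X \<longleftrightarrow> i \<in> X" if "i < n" for i
    using that by (metis PowI chi_singleton empty_subsetI insert_subset lessThan_iff one_neq_neg_one)
  thus ?thesis using X p_in_U[OF X] by auto
qed

end

section \<open>Orbit polytopes\<close>

text \<open>Outside the carrier no convex set would contain \<open>X\<close>, and the hull would be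
  an empty intersection, hence everything.\<close>

lemma convex_vec_hull:
  assumes "X \<subseteq> carrier_vec d"
  shows "convex_vec d (convex_vec d hull X)"
proof -
  have "convex_vec d (carrier_vec d)" by (auto simp: convex_vec_def)
  hence "convex_vec d hull X \<subseteq> carrier_vec d" using assms by (intro hull_minimal)
  thus ?thesis by (fastforce simp: convex_vec_def hull_def)
qed

lemma mult_mat_vec_comb:
  fixes M :: "real mat"
  assumes "M \<in> carrier_mat d d" "x \<in> carrier_vec d" "y \<in> carrier_vec d"
  shows "M *\<^sub>v (s \<cdot>\<^sub>v x + t \<cdot>\<^sub>v y) = s \<cdot>\<^sub>v (M *\<^sub>v x) + t \<cdot>\<^sub>v (M *\<^sub>v y)"
  using assms by (simp add: mult_add_distrib_mat_vec[of M d d] mult_mat_vec[of M d d])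

lemma affine_comb_vec:
  fixes a x y b :: "real vec"
  assumes "x \<in> carrier_vec d" "y \<in> carrier_vec d" "b \<in> carrier_vec d" "s + t = 1"
  shows "s \<cdot>\<^sub>v x + t \<cdot>\<^sub>v y + b = s \<cdot>\<^sub>v (x + b) + t \<cdot>\<^sub>v (y + b)"
proof (rule eq_vecI)
  fix i assume "i < dim_vec (s \<cdot>\<^sub>v (x + b) + t \<cdot>\<^sub>v (y + b))"
  moreover have "b $ i = s * b $ i + t * b $ i" using assms(4) by (metis distrib_right mult_1)
  ultimately show "(s \<cdot>\<^sub>v x + t \<cdot>\<^sub>v y + b) $ i = (s \<cdot>\<^sub>v (x + b) + t \<cdot>\<^sub>v (y + b)) $ i"
    using assms by (simp add: distrib_left)
qed (use assms in simp)

text \<open>The preimage of a convex set under a linear map is convex, so minimality of the hull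
  applies.\<close>

lemma mat_image_hull:
  assumes "M \<in> carrier_mat d d" "X \<subseteq> carrier_vec d" "Y \<subseteq> carrier_vec d"
    and "\<And>x. x \<in> X \<Longrightarrow> M *\<^sub>v x \<in> Y" and "x \<in> convex_vec d hull X"
  shows "M *\<^sub>v x \<in> convex_vec d hull Y"
proof -
  have cY: "convex_vec d (convex_vec d hull Y)" using assms(3) by (rule convex_vec_hull)
  have "convex_vec d {x \<in> carrier_vec d. M *\<^sub>v x \<in> convex_vec d hull Y}"
    using cY assms(1) by (auto simp: convex_vec_def mult_mat_vec_comb)
  moreover have "X \<subseteq> {x \<in> carrier_vec d. M *\<^sub>v x \<in> convex_vec d hull Y}"
    using assms(2,4) hull_subset[of Y "convex_vec d"] by auto
  ultimately have "convex_vec d hull X \<subseteq> {x \<in> carrier_vec d. M *\<^sub>v x \<in> convex_vec d hull Y}"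
    by (intro hull_minimal)
  thus ?thesis using assms(5) by auto
qed

text \<open>The set on which two affine maps agree is convex.\<close>

lemma affine_maps_eq_on_hull:
  assumes "M \<in> carrier_mat d d" "N \<in> carrier_mat d d" "b \<in> carrier_vec d" "X \<subseteq> carrier_vec d"
    and "\<And>x. x \<in> X \<Longrightarrow> M *\<^sub>v x = N *\<^sub>v x + b" and "x \<in> convex_vec d hull X"
  shows "M *\<^sub>v x = N *\<^sub>v x + b"
proof -
  have "convex_vec d {x \<in> carrier_vec d. M *\<^sub>v x = N *\<^sub>v x + b}"
    using assms(1-3)
    by (auto simp: convex_vec_def mult_mat_vec_comb affine_comb_vec[of _ d])
  moreover have "X \<subseteq> {x \<in> carrier_vec d. M *\<^sub>v x = N *\<^sub>v x + b}" using assms(4,5) by auto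
  ultimately have "convex_vec d hull X \<subseteq> {x \<in> carrier_vec d. M *\<^sub>v x = N *\<^sub>v x + b}"
    by (intro hull_minimal)
  thus ?thesis using assms(6) by auto
qed

section \<open>Extreme points and their images under affine symmetries\<close>

definition extreme :: "real vec set \<Rightarrow> real vec \<Rightarrow> bool" where
  "extreme P p \<longleftrightarrow> p \<in> P \<and> (\<forall>x\<in>P. \<forall>y\<in>P. \<forall>s>0. \<forall>t>0. s + t = 1 \<longrightarrow> s \<cdot>\<^sub>v x + t \<cdot>\<^sub>v y = p \<longrightarrow> x = p \<and> y = p)"

text \<open>Removing an extreme point leaves a convex set. If the point were not a generator, this
  smaller set would still contain all generators.\<close>

lemma extreme_in_generators:
  assumes "X \<subseteq> carrier_vec d" "extreme (convex_vec d hull X) p"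
  shows "p \<in> X"
proof (rule ccontr)
  assume p: "p \<notin> X"
  define H where "H = convex_vec d hull X"
  have H: "convex_vec d H" unfolding H_def using assms(1) by (rule convex_vec_hull)
  have car: "x \<in> carrier_vec d" if "x \<in> H" for x using H that by (auto simp: convex_vec_def)
  have "s \<cdot>\<^sub>v x + t \<cdot>\<^sub>v y \<in> H - {p}"
    if xy: "x \<in> H - {p}" "y \<in> H - {p}" and st: "0 \<le> s" "0 \<le> t" "s + t = 1" for x y s t
  \<comment> \<open>Extremality speaks of positive weights only; with a zero weight the combination
    is one of the two end points.\<close>
  proof (cases "s = 0 \<or> t = 0")
    case True
    hence st': "s = 0 \<and> t = 1 \<or> s = 1 \<and> t = 0" using st by auto
    have xy': "x \<in> carrier_vec d" "y \<in> carrier_vec d" using car xy by auto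
    have "0 \<cdot>\<^sub>v w = 0\<^sub>v d" if "w \<in> carrier_vec d" for w :: "real vec"
      using that by (intro eq_vecI) auto
    hence "s \<cdot>\<^sub>v x + t \<cdot>\<^sub>v y \<in> {x, y}" using st' xy' by auto
    thus ?thesis using xy by auto
  next
    case False
    hence pos: "0 < s" "0 < t" using st by auto
    have "s \<cdot>\<^sub>v x + t \<cdot>\<^sub>v y \<noteq> p"
    proof
      assume "s \<cdot>\<^sub>v x + t \<cdot>\<^sub>v y = p"
      hence "x = p" using assms(2) pos xy st(3) unfolding extreme_def H_def[symmetric] by blast
      thus False using xy by simp
    qed
    moreover have "s \<cdot>\<^sub>v x + t \<cdot>\<^sub>v y \<in> H" using H xy st unfolding convex_vec_def by blast
    ultimately show ?thesis by simp
  qed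
  hence "convex_vec d (H - {p})" using car unfolding convex_vec_def by blast
  moreover have "X \<subseteq> H - {p}" using p hull_subset[of X "convex_vec d"] by (auto simp: H_def)
  ultimately have "H \<subseteq> H - {p}" unfolding H_def by (intro hull_minimal)
  thus False using assms(2) by (auto simp: extreme_def H_def)
qed

text \<open>A segment through \<open>f p\<close> pulls back along the bijection to a segment through
  \<open>p\<close> with the same weights.\<close>

lemma affine_symmetry_extreme:
  assumes P: "convex_vec d P" and f: "f \<in> affine_symmetries d P" and p: "extreme P p"
  shows "extreme P (f p)"
proof -
  have bij: "bij_betw f P P" using f by (auto simp: affine_symmetries_def Bij_def)
  obtain M b where Mb: "M \<in> carrier_mat d d" "b \<in> carrier_vec d" "\<And>x. x \<in> P \<Longrightarrow> f x = M *\<^sub>v x + b"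
    using f by (auto simp: affine_symmetries_def)
  have car: "x \<in> carrier_vec d" if "x \<in> P" for x using P that by (auto simp: convex_vec_def)
  have "x = f p \<and> y = f p"
    if xy: "x \<in> P" "y \<in> P" and st: "0 < s" "0 < t" "s + t = 1" and eq: "s \<cdot>\<^sub>v x + t \<cdot>\<^sub>v y = f p" for x y s t
  proof -
    obtain x' y' where x': "x' \<in> P" "x = f x'" and y': "y' \<in> P" "y = f y'"
      using bij xy by (metis bij_betw_imp_surj_on imageE)
    have mem: "s \<cdot>\<^sub>v x' + t \<cdot>\<^sub>v y' \<in> P" using P x' y' st by (auto simp: convex_vec_def)
    have "f (s \<cdot>\<^sub>v x' + t \<cdot>\<^sub>v y') = s \<cdot>\<^sub>v f x' + t \<cdot>\<^sub>v f y'"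
      using Mb x' y' car mem st by (simp add: mult_mat_vec_comb affine_comb_vec[of _ d])
    hence "f (s \<cdot>\<^sub>v x' + t \<cdot>\<^sub>v y') = f p" using eq x' y' by simp
    hence "s \<cdot>\<^sub>v x' + t \<cdot>\<^sub>v y' = p"
      using bij mem p by (auto simp: bij_betw_def inj_on_def extreme_def)
    hence "x' = p \<and> y' = p" using p x' y' st by (auto simp: extreme_def)
    thus ?thesis using x' y' by simp
  qed
  moreover have "f p \<in> P" using bij p by (auto simp: bij_betw_def extreme_def)
  ultimately show ?thesis by (auto simp: extreme_def)
qed

section \<open>The orbit of a vector and the natural map\<close>

locale orbit_rep = group G for G :: "('g, 'm) monoid_scheme" (structure) +
  fixes d :: nat and D :: "'g \<Rightarrow> real mat" and v :: "real vec"
  assumes D_hom: "D \<in> hom G (GL d)" and v: "v \<in> carrier_vec d"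
begin

abbreviation "P \<equiv> orbit_polytope d G D v"

definition orb :: "'g \<Rightarrow> real vec" where "orb g = D g *\<^sub>v v"

lemma D_carrier: "g \<in> carrier G \<Longrightarrow> D g \<in> carrier_mat d d"
  using hom_in_carrier[OF D_hom, of g] by (auto simp: GL_def units_of_def Units_def ring_mat_def)

lemma D_mult: "g \<in> carrier G \<Longrightarrow> h \<in> carrier G \<Longrightarrow> D (g \<otimes> h) = D g * D h"
  using hom_mult[OF D_hom, of g h] by (simp add: GL_def units_of_def ring_mat_def)

lemma orb_carrier: "g \<in> carrier G \<Longrightarrow> orb g \<in> carrier_vec d"
  using D_carrier[of g] v by (auto simp: orb_def)

lemma orbit_subset: "orb ` carrier G \<subseteq> carrier_vec d"
  using orb_carrier by auto

lemma D_orb: "g \<in> carrier G \<Longrightarrow> h \<in> carrier G \<Longrightarrow> D g *\<^sub>v orb h = orb (g \<otimes> h)"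
  using D_carrier[of g] D_carrier[of h] v
  by (simp add: orb_def D_mult assoc_mult_mat_vec[of _ d d _ d])

lemma P_eq: "P = convex_vec d hull (orb ` carrier G)"
  by (simp add: orbit_polytope_def orb_def)

lemma convex_P: "convex_vec d P"
  unfolding P_eq by (rule convex_vec_hull[OF orbit_subset])

lemma P_carrier: "x \<in> P \<Longrightarrow> x \<in> carrier_vec d"
  using convex_P by (auto simp: convex_vec_def)

lemma orb_in_P: "g \<in> carrier G \<Longrightarrow> orb g \<in> P"
  unfolding P_eq by (rule hull_inc) auto

lemma mat_eq_on_P:
  assumes "M \<in> carrier_mat d d" "N \<in> carrier_mat d d" "b \<in> carrier_vec d"
    and "\<And>g. g \<in> carrier G \<Longrightarrow> M *\<^sub>v orb g = N *\<^sub>v orb g + b" "x \<in> P"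
  shows "M *\<^sub>v x = N *\<^sub>v x + b"
  using affine_maps_eq_on_hull[OF assms(1-3) orbit_subset] assms(4,5) by (auto simp: P_eq)

text \<open>Only the action on \<open>P\<close> matters, and \<open>P\<close> may span a proper
  subspace. The inverse is therefore supplied by a second matrix \<open>N\<close> instead of by
  inverting \<open>M\<close>.\<close>

lemma affine_symmetry_if_permutes_orbit:
  assumes M: "M \<in> carrier_mat d d" "\<And>g. g \<in> carrier G \<Longrightarrow> M *\<^sub>v orb g = orb (f g)"
    and N: "N \<in> carrier_mat d d" "\<And>g. g \<in> carrier G \<Longrightarrow> N *\<^sub>v orb g = orb (f' g)"
    and f: "\<And>g. g \<in> carrier G \<Longrightarrow> f g \<in> carrier G" "\<And>g. g \<in> carrier G \<Longrightarrow> f' g \<in> carrier G"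
    and inv: "\<And>g. g \<in> carrier G \<Longrightarrow> f (f' g) = g" "\<And>g. g \<in> carrier G \<Longrightarrow> f' (f g) = g"
  shows "(\<lambda>x\<in>P. M *\<^sub>v x) \<in> affine_symmetries d P"
proof -
  have img: "L *\<^sub>v x \<in> P" if "x \<in> P" "L \<in> carrier_mat d d" "\<And>g. g \<in> carrier G \<Longrightarrow> L *\<^sub>v orb g = orb (h g)"
    "\<And>g. g \<in> carrier G \<Longrightarrow> h g \<in> carrier G" for L x h
    using that(1) mat_image_hull[OF that(2) orbit_subset orbit_subset] that(3,4) unfolding P_eq by auto
  \<comment> \<open>\<open>L * K\<close> and the identity matrix agree on the orbit, hence on its
    hull.\<close>
  have id: "L *\<^sub>v (K *\<^sub>v x) = x" if x: "x \<in> P" and L: "L \<in> carrier_mat d d" "K \<in> carrier_mat d d"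
    "\<And>g. g \<in> carrier G \<Longrightarrow> L *\<^sub>v (K *\<^sub>v orb g) = orb g" for L K x
  proof -
    have "(L * K) *\<^sub>v x = 1\<^sub>m d *\<^sub>v x + 0\<^sub>v d"
      by (rule mat_eq_on_P)
        (use x L orb_carrier in \<open>auto simp: assoc_mult_mat_vec[of _ d d _ d]\<close>)
    thus ?thesis using P_carrier[OF x] L(1,2) by (simp add: assoc_mult_mat_vec[of _ d d _ d])
  qed
  have "bij_betw (\<lambda>x\<in>P. M *\<^sub>v x) P P"
    by (rule bij_betw_byWitness[where f' = "\<lambda>x. N *\<^sub>v x"])
      (use img[OF _ M f(1)] img[OF _ N f(2)] id[OF _ N(1) M(1)] id[OF _ M(1) N(1)] M(2) N(2) f inv in auto)
  moreover have "M *\<^sub>v x = M *\<^sub>v x + 0\<^sub>v d" if "x \<in> P" for x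
    using M(1) P_carrier[OF that] by simp
  ultimately show ?thesis using M(1)
    by (auto simp: affine_symmetries_def Bij_def intro!: bexI[of _ M] bexI[of _ "0\<^sub>v d"])
qed

lemma natural_map_affine_symmetry:
  assumes "g \<in> carrier G"
  shows "natural_map d G D v g \<in> affine_symmetries d P"
  unfolding natural_map_def
  by (rule affine_symmetry_if_permutes_orbit[of _ "\<lambda>h. g \<otimes> h" "D (inv g)" "\<lambda>h. inv g \<otimes> h"])
    (use assms in \<open>simp_all add: D_carrier D_orb m_assoc[symmetric]\<close>)

lemma natural_map_hom: "natural_map d G D v \<in> hom G (affine_symmetry_group d P)"
proof (rule homI)
  fix g h assume gh: "g \<in> carrier G" "h \<in> carrier G"
  have Bij: "natural_map d G D v g \<in> Bij P" if "g \<in> carrier G" for g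
    using natural_map_affine_symmetry[OF that] by (simp add: affine_symmetries_def)
  have "natural_map d G D v (g \<otimes> h) = compose P (natural_map d G D v g) (natural_map d G D v h)"
  proof (rule extensionalityI[of _ P])
    fix x assume x: "x \<in> P"
    hence "natural_map d G D v h x \<in> P" using Bij[OF gh(2)] by (auto simp: Bij_def bij_betw_def)
    thus "natural_map d G D v (g \<otimes> h) x = compose P (natural_map d G D v g) (natural_map d G D v h) x"
      using x gh P_carrier[OF x] D_carrier
      by (simp add: natural_map_def compose_def D_mult assoc_mult_mat_vec[of _ d d _ d])
  qed (auto simp: natural_map_def compose_def)
  thus "natural_map d G D v (g \<otimes> h) =
      natural_map d G D v g \<otimes>\<^bsub>affine_symmetry_group d P\<^esub> natural_map d G D v h"
    using Bij gh by (simp add: affine_symmetry_group_def BijGroup_def)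
qed (simp add: affine_symmetry_group_def natural_map_affine_symmetry)

lemma natural_map_orb: "g \<in> carrier G \<Longrightarrow> h \<in> carrier G \<Longrightarrow> natural_map d G D v g (orb h) = orb (g \<otimes> h)"
  by (simp add: natural_map_def orb_in_P D_orb)

end

section \<open>Realization of the cube group\<close>

definition cube_group :: "nat \<Rightarrow> nat set monoid" where
  "cube_group n = \<lparr>carrier = U n, Group.monoid.mult = (\<triangle>), one = {}\<rparr>"

lemma cube_group_simps [simp]:
  "carrier (cube_group n) = U n" "X \<otimes>\<^bsub>cube_group n\<^esub> Y = X \<triangle> Y" "\<one>\<^bsub>cube_group n\<^esub> = {}"
  by (simp_all add: cube_group_def)

lemma group_cube_group: "group (cube_group n)"
proof (rule groupI)
  fix X assume "X \<in> carrier (cube_group n)"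
  thus "\<exists>Y\<in>carrier (cube_group n). Y \<otimes>\<^bsub>cube_group n\<^esub> X = \<one>\<^bsub>cube_group n\<^esub>"
    by (intro bexI[of _ X]) simp_all
qed (simp_all add: symd_assoc symd_subset)

text \<open>The numbers \<open>1 - e * x\<close> and \<open>1 - e * y\<close> are nonnegative, and
  their combination with positive weights vanishes.\<close>

lemma real_convex_comb_unit:
  fixes s t x y :: real
  assumes "0 < s" "0 < t" "s + t = 1" "\<bar>x\<bar> \<le> 1" "\<bar>y\<bar> \<le> 1" "s * x + t * y = e" "e = 1 \<or> e = -1"
  shows "x = e \<and> y = e"
proof -
  have "s * (1 - e * x) + t * (1 - e * y) = 0"
    using assms(3,6,7) by (auto simp: algebra_simps)
  moreover have "0 \<le> 1 - e * x" "0 \<le> 1 - e * y" using assms(4,5,7) by auto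
  hence "0 \<le> s * (1 - e * x)" "0 \<le> t * (1 - e * y)" using assms(1,2) by simp_all
  ultimately have "s * (1 - e * x) = 0" "t * (1 - e * y) = 0" by linarith+
  thus ?thesis using assms(1,2,7) by auto
qed

text \<open>The representation is diagonal with the characters in \<open>S\<close>, and
  \<open>v\<close> is the all-ones vector. The orbit consists of vertices of the cube with entries
  between -1 and 1; \<open>sep\<close> makes its points distinct, and \<open>rig\<close> shows that
  every affine symmetry comes from the group.\<close>

lemma cube_group_realizable:
  assumes S: "S \<subseteq> U n"
    and sep: "\<And>X. X \<in> U n \<Longrightarrow> (\<forall>A\<in>S. chi A X = 1) \<Longrightarrow> X = {}"
    and rig: "\<And>p X. bij_betw p (U n) (U n) \<Longrightarrow> p {} = {} \<Longrightarrow>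
      (\<And>A. A \<in> S \<Longrightarrow> \<exists>b c. \<forall>X\<in>U n. chi A (p X) = b + (\<Sum>B\<in>S. c B * chi B X)) \<Longrightarrow>
      X \<in> U n \<Longrightarrow> p X = X"
  shows "is_affine_symmetry_group_of_orbit_polytope (cube_group n)"
proof -
  have "finite S" by (rule finite_subset[OF S]) simp
  then obtain xs where xs: "set xs = S" "distinct xs" using finite_distinct_list by blast
  define d where "d = length xs"
  have xs_S: "xs ! i \<in> S" if "i < d" for i using that xs by (auto simp: d_def)
  hence xs_U: "xs ! i \<in> U n" if "i < d" for i using S that by blast
  define D where "D = (\<lambda>X. mat_diag d (\<lambda>i. chi (xs ! i) X))"
  define v :: "real vec" where "v = vec d (\<lambda>_. 1)"
  have DD: "D (X \<triangle> Y) = D X * D Y" for X Y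
    unfolding D_def mat_diag_diag
    by (rule eq_matI) (simp_all add: mat_diag_def chi_symd_right[OF xs_U])
  have "D X \<in> carrier (GL d)" for X
  proof -
    have "D X * D X = 1\<^sub>m d" "D X \<in> carrier_mat d d" by (simp_all add: D_def)
    thus ?thesis unfolding GL_def units_of_def Units_def ring_mat_def by auto
  qed
  hence "D \<in> hom (cube_group n) (GL d)"
    by (intro homI) (simp_all add: DD, simp add: GL_def units_of_def ring_mat_def)
  then interpret orbit_rep "cube_group n" d D v
    by (intro orbit_rep.intro group_cube_group orbit_rep_axioms.intro) (simp_all add: v_def)
  have orb: "orb X = vec d (\<lambda>i. chi (xs ! i) X)" for X
  proof -
    have "D X *\<^sub>v v = vec d (\<lambda>i. chi (xs ! i) X)"
      unfolding D_def v_def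
      by (rule eq_vecI) (auto simp: mat_diag_def scalar_prod_def)
    thus ?thesis by (simp only: orb_def)
  qed
  have inj: "X = Y" if "X \<in> U n" "Y \<in> U n" "orb X = orb Y" for X Y
  proof -
    have "chi A (X \<triangle> Y) = 1" if "A \<in> S" for A
    proof -
      obtain i where i: "i < d" "xs ! i = A" using \<open>A \<in> S\<close> xs(1) by (metis d_def in_set_conv_nth)
      have "orb X $ i = orb Y $ i" using \<open>orb X = orb Y\<close> by simp
      hence "chi A X = chi A Y" using i by (simp add: orb)
      moreover have "A \<in> U n" using that S by blast
      ultimately show ?thesis by (simp add: chi_symd_right)
    qed
    hence "X \<triangle> Y = {}" using sep[OF symd_in_U] that by blast
    thus ?thesis by simp
  qed
  \<comment> \<open>Inside this cube a point with all coordinates 1 or -1 is extreme, so every orbit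
    point is extreme in \<open>P\<close>.\<close>
  have bound: "P \<subseteq> {x \<in> carrier_vec d. \<forall>i<d. \<bar>x $ i\<bar> \<le> 1}" (is "_ \<subseteq> ?Q")
  proof -
    have "s \<cdot>\<^sub>v x + t \<cdot>\<^sub>v y \<in> ?Q" if xy: "x \<in> ?Q" "y \<in> ?Q" and st: "0 \<le> s" "0 \<le> t" "s + t = 1" for x y s t
    proof -
      have "\<bar>s * x $ i + t * y $ i\<bar> \<le> 1" if "i < d" for i
      proof -
        have "\<bar>s * x $ i + t * y $ i\<bar> \<le> s * \<bar>x $ i\<bar> + t * \<bar>y $ i\<bar>"
          using abs_triangle_ineq[of "s * x $ i" "t * y $ i"] st by (simp add: abs_mult)
        also have "\<dots> \<le> s * 1 + t * 1" using xy st that by (intro add_mono mult_left_mono) auto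
        finally show ?thesis using st by simp
      qed
      thus ?thesis using xy by auto
    qed
    hence "convex_vec d ?Q" unfolding convex_vec_def by blast
    moreover have "\<bar>chi A X\<bar> \<le> 1" for A X using chi_cases[of A X] by auto
    hence "orb ` U n \<subseteq> ?Q" by (auto simp: orb)
    ultimately show ?thesis unfolding P_eq cube_group_simps by (intro hull_minimal)
  qed
  have extr: "extreme P (orb X)" if X: "X \<in> U n" for X
    unfolding extreme_def
  proof (intro conjI ballI allI impI)
    show "orb X \<in> P" using X by (intro orb_in_P) simp
    fix x y :: "real vec" and s t :: real
    assume *: "x \<in> P" "y \<in> P" "0 < s" "0 < t" "s + t = 1" "s \<cdot>\<^sub>v x + t \<cdot>\<^sub>v y = orb X"
    have car: "x \<in> carrier_vec d" "y \<in> carrier_vec d" using * P_carrier by auto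
    have "x $ i = chi (xs ! i) X \<and> y $ i = chi (xs ! i) X" if "i < d" for i
    proof (rule real_convex_comb_unit[OF *(3-5)])
      have "(s \<cdot>\<^sub>v x + t \<cdot>\<^sub>v y) $ i = orb X $ i" using * by simp
      thus "s * x $ i + t * y $ i = chi (xs ! i) X" using that car by (simp add: orb)
    qed (use that bound * chi_cases in auto)
    hence "x = orb X" "y = orb X" using car by (auto intro!: eq_vecI simp: orb)
    thus "x = orb X" "y = orb X" by auto
  qed
  have onto: "\<exists>g\<in>U n. f = natural_map d (cube_group n) D v g" if f: "f \<in> affine_symmetries d P" for f
  proof -
    obtain M b where Mb: "M \<in> carrier_mat d d" "b \<in> carrier_vec d" "\<And>x. x \<in> P \<Longrightarrow> f x = M *\<^sub>v x + b"
      using f by (auto simp: affine_symmetries_def)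
    have f_bij: "bij_betw f P P" and f_ext: "f \<in> extensional P"
      using f by (auto simp: affine_symmetries_def Bij_def)
    have "\<exists>Y\<in>U n. f (orb X) = orb Y" if "X \<in> U n" for X
    proof -
      have "f (orb X) \<in> orb ` carrier (cube_group n)"
        by (rule extreme_in_generators[OF orbit_subset])
          (use affine_symmetry_extreme[OF convex_P f extr[OF that]] in \<open>simp add: P_eq\<close>)
      thus ?thesis by auto
    qed
    then obtain p0 where p0: "\<And>X. X \<in> U n \<Longrightarrow> p0 X \<in> U n \<and> f (orb X) = orb (p0 X)" by metis
    \<comment> \<open>Composing with the self-inverse translation by \<open>g\<close> makes the
      permutation fix the identity, as \<open>rig\<close> requires.\<close>
    define g where "g = p0 {}"
    have g: "g \<in> U n" using p0[OF empty_in_U] by (simp add: g_def)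
    define p where "p = (\<lambda>X. g \<triangle> p0 X)"
    have p_U: "p X \<in> U n" if "X \<in> U n" for X
      unfolding p_def using symd_in_U[OF g] p0[OF that] by blast
    have "inj_on p (U n)"
    proof (rule inj_onI)
      fix X Y assume XY: "X \<in> U n" "Y \<in> U n" "p X = p Y"
      hence "p0 X = p0 Y" unfolding p_def by (metis symd_cancel(1))
      hence "f (orb X) = f (orb Y)" using p0[OF XY(1)] p0[OF XY(2)] by simp
      hence "orb X = orb Y"
        using f_bij orb_in_P XY by (auto simp: bij_betw_def inj_on_def simp del: Pow_iff)
      thus "X = Y" using inj XY by blast
    qed
    moreover have "p ` U n \<subseteq> U n" using p_U by blast
    ultimately have p_bij: "bij_betw p (U n) (U n)"
      unfolding bij_betw_def using endo_inj_surj[of "U n" p] by simp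
    have p_empty: "p {} = {}" by (simp add: p_def g_def)
    have aff: "\<exists>b c. \<forall>X\<in>U n. chi A (p X) = b + (\<Sum>B\<in>S. c B * chi B X)" if "A \<in> S" for A
    proof -
      obtain i where i: "i < d" "xs ! i = A" using \<open>A \<in> S\<close> xs(1) by (metis d_def in_set_conv_nth)
      have AU: "A \<in> U n" using that S by blast
      have bij: "bij_betw ((!) xs) {..<d} S"
        using bij_betw_nth[OF xs(2) refl xs(1)[symmetric]] by (simp add: d_def)
      \<comment> \<open>\<open>k B\<close> is the position of \<open>B\<close> in \<open>xs\<close>;
        it turns row \<open>i\<close> of \<open>M\<close> into coefficients indexed by
        \<open>S\<close>. The factor \<open>chi A g\<close> below comes from the translation in
        \<open>p\<close>.\<close>
      define k where "k = the_inv_into {..<d} ((!) xs)"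
      have k: "k (xs ! j) = j" if "j < d" for j
        unfolding k_def using bij that by (intro the_inv_into_f_f) (auto simp: bij_betw_def)
      have "chi A (p X) = chi A g * b $ i + (\<Sum>B\<in>S. (chi A g * M $$ (i, k B)) * chi B X)" if X: "X \<in> U n" for X
      proof -
        have "chi A (p0 X) = orb (p0 X) $ i" using i by (simp add: orb)
        also have "orb (p0 X) = M *\<^sub>v orb X + b"
          using p0[OF X] Mb(3)[OF orb_in_P] X by simp
        also have "(M *\<^sub>v orb X + b) $ i = (\<Sum>j<d. M $$ (i, j) * chi (xs ! j) X) + b $ i"
          using Mb(1,2) i by (simp add: orb scalar_prod_def atLeast0LessThan)
        also have "(\<Sum>j<d. M $$ (i, j) * chi (xs ! j) X) = (\<Sum>j<d. M $$ (i, k (xs ! j)) * chi (xs ! j) X)"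
          by (intro sum.cong refl) (simp add: k)
        also have "\<dots> = (\<Sum>B\<in>S. M $$ (i, k B) * chi B X)"
          by (rule sum.reindex_bij_betw[OF bij])
        finally show ?thesis
          by (simp add: p_def chi_symd_right[OF AU] sum_distrib_left algebra_simps)
      qed
      thus ?thesis
        by (intro exI[of _ "chi A g * b $ i"] exI[of _ "\<lambda>B. chi A g * M $$ (i, k B)"] ballI)
    qed
    have "p0 X = g \<triangle> X" if "X \<in> U n" for X
    proof -
      have "p X = X" by (rule rig[OF p_bij p_empty aff that])
      thus ?thesis by (metis p_def symd_cancel(1))
    qed
    hence "D g *\<^sub>v orb X = M *\<^sub>v orb X + b" if "X \<in> U n" for X
      using p0[OF that] Mb(3)[OF orb_in_P] D_orb[of g X] that g by simp
    hence "D g *\<^sub>v x = f x" if "x \<in> P" for x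
      using mat_eq_on_P[of "D g" M b x] D_carrier[of g] g Mb that by simp
    hence "f = natural_map d (cube_group n) D v g"
      using f_ext by (intro extensionalityI[of _ P]) (auto simp: natural_map_def)
    thus ?thesis using g by blast
  qed
  have "inj_on (natural_map d (cube_group n) D v) (U n)"
  proof (rule inj_onI)
    fix g h assume gh: "g \<in> U n" "h \<in> U n" "natural_map d (cube_group n) D v g = natural_map d (cube_group n) D v h"
    have "orb g = orb h"
      using natural_map_orb[of g "{}"] natural_map_orb[of h "{}"] gh by simp
    thus "g = h" using inj gh by blast
  qed
  moreover have "natural_map d (cube_group n) D v ` U n = affine_symmetries d P"
    using onto natural_map_affine_symmetry by auto
  ultimately have "natural_map d (cube_group n) D v \<in> iso (cube_group n) (affine_symmetry_group d P)"
    using natural_map_hom by (simp add: iso_def bij_betw_def affine_symmetry_group_def)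
  thus ?thesis unfolding is_affine_symmetry_group_of_orbit_polytope_def
    using D_hom v by blast
qed

text \<open>A permutation of at most two elements that fixes one of them is the identity, so all
  characters may be taken.\<close>

lemma cube_group_realizable_0_1:
  assumes "n \<le> 1"
  shows "is_affine_symmetry_group_of_orbit_polytope (cube_group n)"
proof (rule cube_group_realizable[of "U n"])
  have *: "X = {} \<or> X = {0}" if "X \<in> U n" for X
    using assms that by (cases n) (auto simp: lessThan_Suc)
  show "X = {}" if "X \<in> U n" "\<forall>A\<in>U n. chi A X = 1" for X
  proof -
    have "chi X X = 1" using that by blast
    thus ?thesis using *[OF that(1)] by (auto simp: chi_singleton)
  qed
  fix p :: "nat set \<Rightarrow> nat set" and X
  assume p: "bij_betw p (U n) (U n)" "p {} = {}" and X: "X \<in> U n"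
  have "p X \<in> U n" using p X by (auto simp: bij_betw_def simp del: Pow_iff)
  moreover have "p X = {} \<Longrightarrow> X = {}"
    using inj_onD[of p "U n" X "{}"] p X empty_in_U[of n] by (simp add: bij_betw_def del: Pow_iff)
  ultimately show "p X = X" using *[OF X] *[of "p X"] p by auto
qed simp

lemma cube_group_realizable_ge_5:
  assumes "n \<ge> 5"
  shows "is_affine_symmetry_group_of_orbit_polytope (cube_group n)"
proof -
  obtain S where S: "S \<subseteq> U n" "{} \<notin> S" "2 ^ n < 2 * card S" "rigid n S"
    using ex_rigid[OF assms] by blast
  show ?thesis
  proof (rule cube_group_realizable[OF S(1)])
    fix X assume X: "X \<in> U n" "\<forall>A\<in>S. chi A X = 1"
    \<comment> \<open>By density \<open>{i}\<close> is a sum of two elements of \<open>S\<close>, so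
      its character is a product of two that are 1 at \<open>X\<close>.\<close>
    have "chi {i} X = 1" if "i < n" for i
    proof -
      have "{i} \<in> U n" using that by auto
      then obtain B where "B \<in> S" "{i} \<triangle> B \<in> S" using large_subset_triangle[OF S(1,3)] by blast
      thus ?thesis using X chi_symd_left[OF X(1), of "{i}" B] by simp
    qed
    thus "X = {}" using X(1) by (force simp: chi_singleton split: if_splits)
  next
    fix p X assume "bij_betw p (U n) (U n)" "p {} = {}" "X \<in> U n"
      and aff: "\<And>A. A \<in> S \<Longrightarrow> \<exists>b c. \<forall>X\<in>U n. chi A (p X) = b + (\<Sum>B\<in>S. c B * chi B X)"
    then interpret cube_perm n p by unfold_locales
    show "p X = X" by (rule eq_id_if_rigid[OF S(4,1,2) aff \<open>X \<in> U n\<close>])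
  qed
qed

section \<open>Embeddings of elementary abelian 2-groups\<close>

text \<open>For an elementary abelian 2-group these correspond to linearly independent
  \<open>k\<close>-tuples over the field with two elements. A lower bound on their number serves
  twice: to find an isomorphism with the cube group, and to count its automorphisms.\<close>

definition embeddings :: "nat \<Rightarrow> ('g, 'm) monoid_scheme \<Rightarrow> (nat set \<Rightarrow> 'g) set" where
  "embeddings k G = {h \<in> hom (cube_group k) G. inj_on h (U k) \<and> h \<in> extensional (U k)}"

lemma finite_embeddings:
  assumes "finite (carrier G)"
  shows "finite (embeddings k G)"
proof (rule finite_subset)
  show "embeddings k G \<subseteq> (U k \<rightarrow>\<^sub>E carrier G)"
    by (auto simp: embeddings_def hom_def PiE_def Pi_def)
  show "finite (U k \<rightarrow>\<^sub>E carrier G)" using assms by (intro finite_PiE) auto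
qed

locale elementary_abelian_2_group = comm_group G for G (structure) +
  assumes square: "x \<in> carrier G \<Longrightarrow> x \<otimes> x = \<one>"
begin

lemma eq_if_mult_eq_one: "x \<in> carrier G \<Longrightarrow> y \<in> carrier G \<Longrightarrow> x \<otimes> y = \<one> \<Longrightarrow> x = y"
  using square right_cancel[of y x y] by simp

lemma embedding_one:
  assumes "h \<in> hom (cube_group k) G"
  shows "h {} = \<one>"
proof -
  have "h {} \<in> carrier G" using hom_in_carrier[OF assms, of "{}"] by simp
  moreover have "h {} \<otimes> h {} = h {}" using hom_mult[OF assms, of "{}" "{}"] by simp
  ultimately show ?thesis using square by metis
qed

text \<open>For an embedding \<open>h\<close> this is the extension that sends the new basis vector
  \<open>{k}\<close> to \<open>y\<close>.\<close>

definition extend :: "nat \<Rightarrow> (nat set \<Rightarrow> 'a) \<Rightarrow> 'a \<Rightarrow> nat set \<Rightarrow> 'a" where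
  "extend k h y = (\<lambda>A\<in>U (Suc k). h (A - {k}) \<otimes> (if k \<in> A then y else \<one>))"

lemma diff_in_U: "A \<in> U (Suc k) \<Longrightarrow> A - {k} \<in> U k"
  by (auto simp: lessThan_Suc)

lemma extend_embedding:
  assumes h: "h \<in> embeddings k G" and y: "y \<in> carrier G - h ` U k"
  shows "extend k h y \<in> embeddings (Suc k) G"
proof -
  have hom: "h \<in> hom (cube_group k) G" and inj: "inj_on h (U k)"
    using h by (auto simp: embeddings_def)
  have cl: "h A \<in> carrier G" if "A \<in> U k" for A
    using hom_in_carrier[OF hom, of A] that by simp
  have mult: "h (A \<triangle> B) = h A \<otimes> h B" if "A \<in> U k" "B \<in> U k" for A B
    using hom_mult[OF hom, of A B] that by simp
  have ext: "extend k h y A = h (A - {k}) \<otimes> (if k \<in> A then y else \<one>)" if "A \<in> U (Suc k)" for A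
    using that by (simp add: extend_def)
  have ext_cl: "extend k h y A \<in> carrier G" if "A \<in> U (Suc k)" for A
    using cl[OF diff_in_U[OF that]] y by (simp add: ext[OF that])
  have ext_mult: "extend k h y (A \<triangle> B) = extend k h y A \<otimes> extend k h y B"
    if AB: "A \<in> U (Suc k)" "B \<in> U (Suc k)" for A B
  proof -
    have "A \<triangle> B - {k} = (A - {k}) \<triangle> (B - {k})" "k \<in> A \<triangle> B \<longleftrightarrow> (k \<in> A) \<noteq> (k \<in> B)"
      by (auto simp: symd_def)
    moreover have "z \<otimes> w = z \<otimes> y \<otimes> (w \<otimes> y)" if "z \<in> carrier G" "w \<in> carrier G" for z w
    proof -
      have "z \<otimes> y \<otimes> (w \<otimes> y) = z \<otimes> w \<otimes> (y \<otimes> y)" using that y by (simp add: m_ac)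
      thus ?thesis using that y square by simp
    qed
    ultimately show ?thesis
      using cl[OF diff_in_U[OF AB(1)]] cl[OF diff_in_U[OF AB(2)]] y
      by (simp add: ext[OF AB(1)] ext[OF AB(2)] ext[OF symd_in_U[OF AB]]
          mult[OF diff_in_U[OF AB(1)] diff_in_U[OF AB(2)]] m_ac)
  qed
  have "A = B" if AB: "A \<in> U (Suc k)" "B \<in> U (Suc k)" and eq: "extend k h y A = extend k h y B" for A B
  proof -
    \<comment> \<open>Injectivity is reduced to the kernel. An element of the kernel containing
      \<open>k\<close> would put \<open>y\<close> into the image of \<open>h\<close>.\<close>
    have C: "A \<triangle> B \<in> U (Suc k)" using AB by (rule symd_in_U)
    have "extend k h y (A \<triangle> B) = \<one>"
      using ext_mult[OF AB] eq square[OF ext_cl[OF AB(2)]] by simp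
    hence one: "h (A \<triangle> B - {k}) \<otimes> (if k \<in> A \<triangle> B then y else \<one>) = \<one>" by (simp only: ext[OF C])
    have k: "k \<notin> A \<triangle> B"
    proof
      assume "k \<in> A \<triangle> B"
      hence "h (A \<triangle> B - {k}) = y"
        using one y by (intro eq_if_mult_eq_one[OF cl[OF diff_in_U[OF C]]]) simp_all
      thus False using y imageI[OF diff_in_U[OF C], of h] by (simp del: Pow_iff)
    qed
    hence "h (A \<triangle> B) = h {}"
      using one cl[OF diff_in_U[OF C]] embedding_one[OF hom] by simp
    moreover have "A \<triangle> B \<in> U k" using k diff_in_U[OF C] by simp
    ultimately have "A \<triangle> B = {}" using inj empty_in_U unfolding inj_on_def by blast
    thus ?thesis by simp
  qed
  thus ?thesis using ext_cl ext_mult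
    by (auto simp: embeddings_def hom_def inj_on_def extend_def simp del: Pow_iff)
qed

text \<open>Both data are recovered from the extension: \<open>h\<close> from its values on
  \<open>U k\<close>, and \<open>y\<close> as its value at \<open>{k}\<close>.\<close>

lemma card_embeddings_Suc:
  assumes fin: "finite (carrier G)"
  shows "card (embeddings k G) * (order G - 2 ^ k) \<le> card (embeddings (Suc k) G)"
proof -
  let ?Z = "SIGMA h:embeddings k G. carrier G - h ` U k"
  have "card (carrier G - h ` U k) = order G - 2 ^ k" if "h \<in> embeddings k G" for h
  proof -
    have "h ` U k \<subseteq> carrier G" using that by (auto simp: embeddings_def hom_def simp del: Pow_iff)
    moreover have "card (h ` U k) = 2 ^ k" using that card_U[of k] by (simp add: embeddings_def card_image)
    ultimately show ?thesis by (simp add: card_Diff_subset order_def)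
  qed
  hence "card ?Z = card (embeddings k G) * (order G - 2 ^ k)"
    using fin finite_embeddings[OF fin, of k] by simp
  moreover have "inj_on (\<lambda>(h, y). extend k h y) ?Z"
  proof (rule inj_onI, clarify)
    fix h y h' y' assume h: "h \<in> embeddings k G" "y \<in> carrier G" "h' \<in> embeddings k G" "y' \<in> carrier G"
      and eq: "extend k h y = extend k h' y'"
    have hom: "h \<in> hom (cube_group k) G" "h' \<in> hom (cube_group k) G"
      using h by (auto simp: embeddings_def)
    have "h = h'"
    proof (rule extensionalityI[of _ "U k"])
      fix A assume A: "A \<in> U k"
      hence "k \<notin> A" "A \<in> U (Suc k)" by auto
      moreover have "h A \<in> carrier G" "h' A \<in> carrier G"
        using hom_in_carrier[OF hom(1), of A] hom_in_carrier[OF hom(2), of A] A by auto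
      ultimately show "h A = h' A" using fun_cong[OF eq, of A] by (simp add: extend_def)
    qed (use h in \<open>auto simp: embeddings_def\<close>)
    moreover have "y = y'"
      using fun_cong[OF eq, of "{k}"] h embedding_one[OF hom(1)] embedding_one[OF hom(2)]
      by (simp add: extend_def)
    ultimately show "h = h' \<and> y = y'" by simp
  qed
  moreover have "(\<lambda>(h, y). extend k h y) ` ?Z \<subseteq> embeddings (Suc k) G"
    using extend_embedding by auto
  ultimately show ?thesis
    using card_inj_on_le[OF _ _ finite_embeddings[OF fin]] by metis
qed

text \<open>For \<open>order G = 2 ^ n\<close> and \<open>k = n\<close> the product is the order of
  GL(n,2).\<close>

lemma card_embeddings_ge:
  assumes fin: "finite (carrier G)"
  shows "(\<Prod>i<k. order G - 2 ^ i) \<le> card (embeddings k G)"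
proof (induction k)
  case 0
  have "(\<lambda>A\<in>U 0. \<one>) \<in> embeddings 0 G"
    by (auto simp: embeddings_def hom_def)
  thus ?case using finite_embeddings[OF fin, of 0] by (auto simp: card_gt_0_iff Suc_le_eq)
next
  case (Suc k)
  show ?case
    using order_trans[OF mult_le_mono1[OF Suc.IH] card_embeddings_Suc[OF fin, of k]] by simp
qed

text \<open>The lower bound is positive, so an embedding exists, and equal orders make it
  onto.\<close>

lemma ex_iso_cube_group:
  assumes "order G = 2 ^ n"
  shows "\<exists>h. h \<in> iso (cube_group n) G"
proof -
  have fin: "finite (carrier G)" using assms by (metis order_def card.infinite power_not_zero zero_neq_numeral)
  have "0 < (\<Prod>i<n. order G - 2 ^ i)" unfolding assms by (intro prod_pos) simp
  hence "0 < card (embeddings n G)" using card_embeddings_ge[OF fin, of n] by linarith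
  then obtain h where h: "h \<in> hom (cube_group n) G" "inj_on h (U n)"
    by (auto simp: card_gt_0_iff embeddings_def)
  have "h ` U n \<subseteq> carrier G" using h by (auto simp: hom_def simp del: Pow_iff)
  moreover have "card (h ` U n) = card (carrier G)"
    using card_U[of n] assms by (simp add: card_image[OF h(2)] order_def)
  ultimately have "h ` U n = carrier G" using fin by (intro card_subset_eq) auto
  thus ?thesis using h by (auto simp: iso_def bij_betw_def)
qed

end

text \<open>Precomposing the representation with the isomorphism leaves the orbit, and so the
  polytope, unchanged.\<close>

lemma realizable_transfer:
  assumes G: "is_affine_symmetry_group_of_orbit_polytope G" and h: "h \<in> iso H G"
  shows "is_affine_symmetry_group_of_orbit_polytope H"
proof -
  obtain d D v where D: "D \<in> hom G (GL d)" "v \<in> carrier_vec d"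
    "natural_map d G D v \<in> iso G (affine_symmetry_group d (orbit_polytope d G D v))"
    using G by (auto simp: is_affine_symmetry_group_of_orbit_polytope_def)
  have hom: "h \<in> hom H G" and img: "h ` carrier H = carrier G"
    using h by (auto simp: iso_def bij_betw_def)
  have "(\<lambda>x. (D \<circ> h) x *\<^sub>v v) ` carrier H = (\<lambda>g. D g *\<^sub>v v) ` h ` carrier H"
    unfolding image_image by simp
  hence P: "orbit_polytope d H (D \<circ> h) v = orbit_polytope d G D v"
    by (simp add: orbit_polytope_def img)
  have "natural_map d H (D \<circ> h) v = natural_map d G D v \<circ> h"
    by (auto simp: natural_map_def P)
  hence "natural_map d H (D \<circ> h) v \<in> iso H (affine_symmetry_group d (orbit_polytope d H (D \<circ> h) v))"
    using iso_set_trans[OF h D(3)] by (simp add: P)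
  moreover have "D \<circ> h \<in> hom H (GL d)" using hom D(1) by (rule Group.hom_compose)
  ultimately show ?thesis
    unfolding is_affine_symmetry_group_of_orbit_polytope_def using D(2) by blast
qed

section \<open>Dimensions 2, 3 and 4\<close>

lemma elementary_abelian_2_cube_group: "elementary_abelian_2_group (cube_group n)"
  by (intro elementary_abelian_2_group.intro elementary_abelian_2_group_axioms.intro
      group.group_comm_groupI group_cube_group) (simp_all add: symd_commute)

section \<open>Automorphisms of the cube group and their action on characters\<close>

text \<open>The transpose of an automorphism \<open>h\<close>, read off from the values of the
  character \<open>chi A\<close> composed with \<open>h\<close> at the basis vectors.\<close>

definition adjoint :: "nat \<Rightarrow> (nat set \<Rightarrow> nat set) \<Rightarrow> nat set \<Rightarrow> nat set" where
  "adjoint n h A = {i. i < n \<and> chi A (h {i}) = -1}"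

lemma adjoint_in_U: "adjoint n h A \<in> U n"
  by (auto simp: adjoint_def)

lemma chi_eq_iff:
  assumes "\<And>X. X \<in> U n \<Longrightarrow> chi A X = chi B X" "A \<in> U n" "B \<in> U n"
  shows "A = B"
proof -
  have "i \<in> A \<longleftrightarrow> i \<in> B" if "i < n" for i
  proof -
    have "{i} \<in> U n" using that by auto
    hence "chi {i} A = chi {i} B" using assms(1) by (metis chi_commute)
    thus ?thesis by (auto simp: chi_singleton split: if_splits)
  qed
  thus ?thesis using assms(2,3) by auto
qed

locale cube_automorphism =
  fixes n h
  assumes h: "h \<in> embeddings n (cube_group n)"
begin

lemma h_in_U: "X \<in> U n \<Longrightarrow> h X \<in> U n"
  using h by (auto simp: embeddings_def hom_def simp del: Pow_iff)

lemma h_symd: "X \<in> U n \<Longrightarrow> Y \<in> U n \<Longrightarrow> h (X \<triangle> Y) = h X \<triangle> h Y"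
  using h by (simp add: embeddings_def hom_def del: Pow_iff)

lemma h_empty: "h {} = {}"
  using h_symd[OF empty_in_U empty_in_U] by simp

lemma h_bij: "bij_betw h (U n) (U n)"
proof -
  have "inj_on h (U n)" using h by (simp add: embeddings_def)
  moreover have "h ` U n \<subseteq> U n" using h_in_U by blast
  ultimately show ?thesis unfolding bij_betw_def using endo_inj_surj[of "U n" h] by simp
qed

text \<open>Both sides are multiplicative in \<open>X\<close> and agree on basis vectors.\<close>

lemma chi_adjoint:
  assumes A: "A \<in> U n" and X: "X \<in> U n"
  shows "chi A (h X) = chi (adjoint n h A) X"
  using finite_U[OF X] X
proof (induction X rule: finite_induct)
  case (insert i F)
  have i: "{i} \<in> U n" "i < n" and F: "F \<in> U n" using insert.prems by auto
  have "insert i F = {i} \<triangle> F" using insert.hyps by (auto simp: symd_def)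
  moreover have "chi A (h {i}) = chi (adjoint n h A) {i}"
    using i chi_cases[of A "h {i}"] by (auto simp: chi_commute[of _ "{i}"] chi_singleton adjoint_def)
  ultimately show ?case
    using insert.IH[OF F] by (simp add: h_symd[OF i(1) F] chi_symd_right[OF A] chi_symd_right[OF adjoint_in_U])
qed (simp add: h_empty)

lemma inj_adjoint: "inj_on (adjoint n h) (U n)"
proof (rule inj_onI)
  fix A B assume AB: "A \<in> U n" "B \<in> U n" "adjoint n h A = adjoint n h B"
  show "A = B"
  proof (rule chi_eq_iff[OF _ AB(1,2)])
    fix Y assume "Y \<in> U n"
    then obtain X where "X \<in> U n" "Y = h X" using h_bij by (metis bij_betw_imp_surj_on imageE)
    thus "chi A Y = chi B Y" using chi_adjoint AB by simp
  qed
qed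

lemma bij_adjoint: "bij_betw (adjoint n h) (U n) (U n)"
proof -
  have "adjoint n h ` U n \<subseteq> U n" using adjoint_in_U by blast
  thus ?thesis unfolding bij_betw_def using endo_inj_surj[of "U n"] inj_adjoint by simp
qed

lemma adjoint_empty: "adjoint n h {} = {}"
  by (simp add: adjoint_def)

end

section \<open>Counting automorphisms against sets of characters\<close>

text \<open>The product bounds are 6, 168 and 20160, to be doubled and compared with 8, 128 and
  32768.\<close>

lemma two_card_embeddings_gt:
  assumes "n \<in> {2, 3, 4}"
  shows "2 ^ (2 ^ n - 1) < 2 * card (embeddings n (cube_group n))"
proof -
  interpret elementary_abelian_2_group "cube_group n" by (rule elementary_abelian_2_cube_group)
  have "order (cube_group n) = 2 ^ n" using card_U[of n] by (simp add: order_def)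
  hence "(\<Prod>i<n. 2 ^ n - 2 ^ i) \<le> card (embeddings n (cube_group n))"
    using card_embeddings_ge[of n] by simp
  moreover have "2 ^ (2 ^ n - 1) < 2 * (\<Prod>i<n. 2 ^ n - 2 ^ i :: nat)"
    using assms by (auto simp: lessThan_nat_numeral)
  ultimately show ?thesis by linarith
qed

text \<open>If \<open>F\<close> were injective, the sets \<open>F h\<close> and their complements
  would be \<open>2 * card E\<close> different subsets of \<open>V\<close>. The two families are
  disjoint because \<open>k\<close> and \<open>card V - k\<close> have different parity.\<close>

lemma equal_subsets_pigeonhole:
  assumes V: "finite V" "odd (card V)" and E: "finite E" "2 ^ card V < 2 * card E"
    and F: "\<And>h. h \<in> E \<Longrightarrow> F h \<subseteq> V" "\<And>h. h \<in> E \<Longrightarrow> card (F h) = k"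
  shows "\<exists>h\<in>E. \<exists>h'\<in>E. h \<noteq> h' \<and> F h = F h'"
proof (rule ccontr)
  assume "\<not> ?thesis"
  hence inj: "inj_on F E" by (auto simp: inj_on_def)
  have compl: "V - (V - F h) = F h" if "h \<in> E" for h using F(1)[OF that] by blast
  have inj2: "inj_on (\<lambda>h. V - F h) E"
    using inj compl by (intro inj_onI) (metis inj_onD)
  have "F ` E \<inter> (\<lambda>h. V - F h) ` E = {}"
  proof (rule ccontr)
    assume "\<not> ?thesis"
    then obtain h h' where hh: "h \<in> E" "h' \<in> E" "F h = V - F h'" by auto
    have "finite (F h')" using F(1)[OF hh(2)] V(1) by (rule finite_subset)
    hence "card (F h) = card V - card (F h')"
      unfolding hh(3) using F(1)[OF hh(2)] by (rule card_Diff_subset)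
    moreover have "card (F h') \<le> card V" using V(1) F(1)[OF hh(2)] by (rule card_mono)
    ultimately show False using F(2)[OF hh(1)] F(2)[OF hh(2)] V(2) by presburger
  qed
  hence "card (F ` E \<union> (\<lambda>h. V - F h) ` E) = 2 * card E"
    using E(1) by (simp add: card_Un_disjoint card_image[OF inj] card_image[OF inj2])
  moreover have "F ` E \<union> (\<lambda>h. V - F h) ` E \<subseteq> Pow V" using F(1) by blast
  hence "card (F ` E \<union> (\<lambda>h. V - F h) ` E) \<le> card (Pow V)"
    using V(1) by (intro card_mono) auto
  ultimately show False using E(2) by (simp add: card_Pow[OF V(1)])
qed

lemma ex_two_automorphisms:
  assumes n: "n \<in> {2, 3, 4}" and S: "S \<subseteq> U n - {{}}"
  shows "\<exists>h\<in>embeddings n (cube_group n). \<exists>h'\<in>embeddings n (cube_group n).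
    h \<noteq> h' \<and> adjoint n h ` S = adjoint n h' ` S"
proof (rule equal_subsets_pigeonhole)
  show "finite (U n - {{}})" by simp
  have card: "card (U n - {{}}) = 2 ^ n - 1" using card_U[of n] by (subst card_Diff_subset) auto
  show "odd (card (U n - {{}}))" unfolding card using n by auto
  show "finite (embeddings n (cube_group n))" by (rule finite_embeddings) simp
  show "2 ^ card (U n - {{}}) < 2 * card (embeddings n (cube_group n))"
    unfolding card by (rule two_card_embeddings_gt[OF n])
  fix h assume "h \<in> embeddings n (cube_group n)"
  then interpret cube_automorphism n h by unfold_locales
  have SU: "S \<subseteq> U n" using S by blast
  have "adjoint n h A \<noteq> {}" if "A \<in> S" for A
  proof
    assume "adjoint n h A = {}"
    hence "A = {}"
      using inj_onD[OF inj_adjoint, of A "{}"] adjoint_empty subsetD[OF SU that] empty_in_U[of n]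
      by (simp del: Pow_iff)
    thus False using S that by blast
  qed
  thus "adjoint n h ` S \<subseteq> U n - {{}}" using adjoint_in_U by blast
  show "card (adjoint n h ` S) = card S"
    using inj_adjoint SU by (intro card_image) (rule inj_on_subset)
qed

lemma bij_betw_self_inverse:
  assumes "bij_betw f A A"
  obtains g where "bij_betw g A A" "\<And>x. x \<in> A \<Longrightarrow> f (g x) = x" "\<And>x. x \<in> A \<Longrightarrow> g (f x) = x"
    "\<And>x. x \<in> A \<Longrightarrow> g x \<in> A"
proof
  show bij: "bij_betw (the_inv_into A f) A A" using assms by (rule bij_betw_the_inv_into)
  show "f (the_inv_into A f x) = x" if "x \<in> A" for x
    using f_the_inv_into_f_bij_betw[OF assms] that by simp
  show "the_inv_into A f (f x) = x" if "x \<in> A" for x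
    using assms that by (intro the_inv_into_f_f) (auto simp: bij_betw_def)
  show "the_inv_into A f x \<in> A" if "x \<in> A" for x
    using bij that by (rule bij_betwE[rule_format])
qed

text \<open>Two automorphisms \<open>h\<close> and \<open>h'\<close> whose adjoints map the
  characters to the same set give \<open>c\<close>, the composite of \<open>h\<close> with the
  inverse of \<open>h'\<close>. Its adjoint \<open>s\<close> stabilizes that set of
  characters.\<close>

lemma ex_stabilizing_automorphism:
  assumes n: "n \<in> {2, 3, 4}"
  obtains c s where "bij_betw c (U n) (U n)" "bij_betw s (U n) (U n)"
    "\<And>A X. A \<in> U n \<Longrightarrow> X \<in> U n \<Longrightarrow> chi A (c X) = chi (s A) X"
    "\<And>A. A \<in> U n \<Longrightarrow> s A \<in> S \<longleftrightarrow> A \<in> S" "\<exists>X\<in>U n. c X \<noteq> X"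
proof -
  \<comment> \<open>Adjoints fix the trivial character, which is left out so that the number of
    available characters is odd.\<close>
  let ?S = "S \<inter> (U n - {{}})"
  obtain h h' where hh: "h \<in> embeddings n (cube_group n)" "h' \<in> embeddings n (cube_group n)"
    "h \<noteq> h'" "adjoint n h ` ?S = adjoint n h' ` ?S"
    using ex_two_automorphisms[OF n Int_lower2[of S]] by (elim bexE conjE)
  interpret h: cube_automorphism n h using hh by unfold_locales
  interpret h': cube_automorphism n h' using hh by unfold_locales
  obtain k where k: "bij_betw k (U n) (U n)" "\<And>X. X \<in> U n \<Longrightarrow> h' (k X) = X" "\<And>X. X \<in> U n \<Longrightarrow> k (h' X) = X"
    and kU: "\<And>X. X \<in> U n \<Longrightarrow> k X \<in> U n"
    using bij_betw_self_inverse[OF h'.h_bij] by metis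
  obtain a where a: "bij_betw a (U n) (U n)" "\<And>X. X \<in> U n \<Longrightarrow> adjoint n h' (a X) = X"
    and aU: "\<And>X. X \<in> U n \<Longrightarrow> a X \<in> U n"
    using bij_betw_self_inverse[OF h'.bij_adjoint] by metis
  define s where "s = (\<lambda>A. a (adjoint n h A))"
  have sU: "s A \<in> U n" for A unfolding s_def by (rule aU[OF adjoint_in_U])
  have adj_s: "adjoint n h' (s A) = adjoint n h A" for A unfolding s_def by (rule a(2)[OF adjoint_in_U])
  have s_empty: "s A = {} \<longleftrightarrow> A = {}" if "A \<in> U n" for A
    using inj_onD[OF h.inj_adjoint, of A "{}"] inj_onD[OF h'.inj_adjoint, of "s A" "{}"] adj_s[of A]
      h.adjoint_empty h'.adjoint_empty sU[of A] that empty_in_U[of n] by (metis (no_types))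
  have "bij_betw (\<lambda>X. h (k X)) (U n) (U n)" using bij_betw_trans[OF k(1) h.h_bij] by (simp add: comp_def)
  moreover have "bij_betw s (U n) (U n)"
    using bij_betw_trans[OF h.bij_adjoint a(1)] by (simp add: comp_def s_def)
  moreover have "chi A (h (k X)) = chi (s A) X" if "A \<in> U n" "X \<in> U n" for A X
    using h.chi_adjoint[OF that(1) kU[OF that(2)]] h'.chi_adjoint[OF sU kU[OF that(2)], of A]
    by (simp add: adj_s k(2)[OF that(2)])
  moreover have "s A \<in> S \<longleftrightarrow> A \<in> S" if A: "A \<in> U n" for A
  proof (cases "A = {}")
    case True
    thus ?thesis using s_empty[OF A] by simp
  next
    case False
    hence "A \<in> S \<longleftrightarrow> A \<in> ?S" using A by blast
    also have "\<dots> \<longleftrightarrow> adjoint n h A \<in> adjoint n h ` ?S"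
      using h.inj_adjoint A by (intro inj_on_image_mem_iff[symmetric]) auto
    also have "\<dots> \<longleftrightarrow> adjoint n h' (s A) \<in> adjoint n h' ` ?S" by (simp only: hh(4) adj_s)
    also have "\<dots> \<longleftrightarrow> s A \<in> ?S"
      using h'.inj_adjoint sU by (intro inj_on_image_mem_iff) auto
    finally show ?thesis using s_empty[OF A] sU[of A] False by blast
  qed
  moreover have "\<exists>X\<in>U n. h (k X) \<noteq> X"
  proof (rule ccontr)
    assume "\<not> ?thesis"
    hence "h X = h' X" if "X \<in> U n" for X using k(3)[OF that] h'.h_in_U[OF that] by metis
    hence "h = h'" using hh(1,2) by (intro extensionalityI[of _ "U n"]) (auto simp: embeddings_def)
    thus False using hh(3) by simp
  qed
  ultimately show thesis by (rule that[of "\<lambda>X. h (k X)" s])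
qed

section \<open>Linear extension of automorphisms that stabilize the support\<close>

locale cube_rep = orbit_rep "cube_group n" d D v for n d D v
begin

text \<open>The vector of entries \<open>coord A i\<close> is the component of \<open>v\<close> on
  which the group acts by \<open>chi A\<close>; \<open>support\<close> collects the characters that
  occur.\<close>

definition coord :: "nat set \<Rightarrow> nat \<Rightarrow> real" where
  "coord A i = fourier n (\<lambda>X. orb X $ i) A"

definition support :: "nat set set" where
  "support = {A \<in> U n. \<exists>i<d. coord A i \<noteq> 0}"

text \<open>
  With \<open>u\<close> the vector of entries \<open>coord B\<close> and \<open>p\<close> the projection onto the \<open>chi B\<close>-isotypic
  component, this is the functional \<open>y \<mapsto> (u \<bullet> p y) / (u \<bullet> u)\<close>; it is 0 when \<open>u = 0\<close>.
\<close>

definition functional :: "nat set \<Rightarrow> nat \<Rightarrow> real" where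
  "functional B j = (\<Sum>Y\<in>U n. chi B Y * (\<Sum>i<d. coord B i * D Y $$ (i, j))) / (2 ^ n * (\<Sum>i<d. (coord B i)\<^sup>2))"

lemma orb_eq: "X \<in> U n \<Longrightarrow> orb X $ i = (\<Sum>A\<in>U n. coord A i * chi A X)"
  unfolding coord_def by (rule fourier_inversion[symmetric])

lemma D_orb_index:
  assumes "X \<in> U n" "Y \<in> U n" "i < d"
  shows "(\<Sum>j<d. D Y $$ (i, j) * orb X $ j) = orb (Y \<triangle> X) $ i"
proof -
  have "orb (Y \<triangle> X) = D Y *\<^sub>v orb X" using D_orb[of Y X] assms by simp
  thus ?thesis
    using assms D_carrier[of Y] orb_carrier[of X]
    by (simp add: scalar_prod_def atLeast0LessThan carrier_vecD carrier_matD)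
qed

text \<open>The substitution \<open>Y\<close> to \<open>X \<triangle> Y\<close> extracts the factor
  \<open>chi B X\<close>: translating the orbit point scales its isotypic component.\<close>

lemma coord_translate:
  assumes "X \<in> U n" and B: "B \<in> U n"
  shows "(\<Sum>Y\<in>U n. chi B Y * orb (Y \<triangle> X) $ i) = 2 ^ n * (chi B X * coord B i)"
proof -
  have "(\<Sum>Y\<in>U n. chi B Y * orb (Y \<triangle> X) $ i) = (\<Sum>Y\<in>U n. chi B (X \<triangle> Y) * orb ((X \<triangle> Y) \<triangle> X) $ i)"
    by (rule sum.reindex_bij_betw[OF bij_betw_symd[OF assms(1)], symmetric])
  also have "\<dots> = (\<Sum>Y\<in>U n. chi B X * (orb Y $ i * chi B Y))"
  proof (intro sum.cong refl)
    fix Y assume Y: "Y \<in> U n"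
    show "chi B (X \<triangle> Y) * orb ((X \<triangle> Y) \<triangle> X) $ i = chi B X * (orb Y $ i * chi B Y)"
      by (simp add: symd_commute[of X Y] chi_symd_right[OF B])
  qed
  also have "\<dots> = 2 ^ n * (chi B X * coord B i)"
    unfolding coord_def fourier_def by (subst sum_distrib_left[symmetric]) simp
  finally show ?thesis .
qed

text \<open>On the orbit, each character in the support is thus the restriction of a linear
  functional.\<close>

lemma functional_orb:
  assumes "X \<in> U n" "B \<in> support"
  shows "(\<Sum>j<d. functional B j * orb X $ j) = chi B X"
proof -
  let ?q = "\<Sum>i<d. (coord B i)\<^sup>2"
  have B: "B \<in> U n" using assms(2) by (simp add: support_def)
  obtain i where "i < d" "coord B i \<noteq> 0" using assms(2) by (auto simp: support_def)
  \<comment> \<open>This excludes the default value of division by zero in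
    \<open>functional\<close>.\<close>
  hence q: "?q > 0" by (intro sum_pos2[of _ i]) auto
  have "(\<Sum>j<d. functional B j * orb X $ j) =
    (\<Sum>j<d. \<Sum>Y\<in>U n. \<Sum>i<d. chi B Y * (coord B i * (D Y $$ (i, j) * orb X $ j))) / (2 ^ n * ?q)"
    by (simp add: functional_def sum_divide_distrib sum_distrib_left sum_distrib_right mult_ac)
  also have "(\<Sum>j<d. \<Sum>Y\<in>U n. \<Sum>i<d. chi B Y * (coord B i * (D Y $$ (i, j) * orb X $ j))) =
    (\<Sum>Y\<in>U n. \<Sum>j<d. \<Sum>i<d. chi B Y * (coord B i * (D Y $$ (i, j) * orb X $ j)))"
    by (rule sum.swap)
  also have "\<dots> = (\<Sum>Y\<in>U n. \<Sum>i<d. \<Sum>j<d. chi B Y * (coord B i * (D Y $$ (i, j) * orb X $ j)))"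
    by (rule sum.cong[OF refl]) (rule sum.swap)
  also have "\<dots> = (\<Sum>Y\<in>U n. \<Sum>i<d. chi B Y * (coord B i * orb (Y \<triangle> X) $ i))"
    by (intro sum.cong refl)
      (simp add: sum_distrib_left[symmetric] D_orb_index[OF assms(1)] del: Pow_iff)
  also have "\<dots> = (\<Sum>i<d. \<Sum>Y\<in>U n. chi B Y * (coord B i * orb (Y \<triangle> X) $ i))"
    by (rule sum.swap)
  also have "\<dots> = (\<Sum>i<d. coord B i * (\<Sum>Y\<in>U n. chi B Y * orb (Y \<triangle> X) $ i))"
    by (simp add: sum_distrib_left mult_ac)
  also have "\<dots> = 2 ^ n * chi B X * ?q"
    by (simp add: coord_translate[OF assms(1) B] sum_distrib_left power2_eq_square mult_ac del: Pow_iff)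
  finally show ?thesis using q by simp
qed

text \<open>The matrix combines the components of \<open>v\<close> with the functionals for
  \<open>s A\<close>, so it maps \<open>orb X\<close> to the sum of \<open>coord A\<close> times
  \<open>chi (s A) X\<close>, which is \<open>chi A (c X)\<close>. Characters outside the support
  contribute nothing.\<close>

lemma ex_matrix:
  assumes c: "\<And>X. X \<in> U n \<Longrightarrow> c X \<in> U n"
    and chi: "\<And>A X. A \<in> U n \<Longrightarrow> X \<in> U n \<Longrightarrow> chi A (c X) = chi (s A) X"
    and s: "\<And>A. A \<in> U n \<Longrightarrow> s A \<in> support \<longleftrightarrow> A \<in> support"
  shows "\<exists>M\<in>carrier_mat d d. \<forall>X\<in>U n. M *\<^sub>v orb X = orb (c X)"
proof -
  define M where "M = mat d d (\<lambda>(i, j). \<Sum>A\<in>U n. coord A i * functional (s A) j)"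
  have "M *\<^sub>v orb X = orb (c X)" if X: "X \<in> U n" for X
  proof (rule eq_vecI)
    have car: "dim_vec (orb X) = d" "dim_vec (orb (c X)) = d"
      using orb_carrier[of X] orb_carrier[of "c X"] X c[OF X] by (auto simp: carrier_vecD)
    thus "dim_vec (M *\<^sub>v orb X) = dim_vec (orb (c X))" by (simp add: M_def)
    fix i assume "i < dim_vec (orb (c X))"
    hence i: "i < d" using car by simp
    have "(M *\<^sub>v orb X) $ i = (\<Sum>j<d. (\<Sum>A\<in>U n. coord A i * functional (s A) j) * orb X $ j)"
      using i car by (simp add: M_def scalar_prod_def atLeast0LessThan)
    also have "\<dots> = (\<Sum>j<d. \<Sum>A\<in>U n. coord A i * (functional (s A) j * orb X $ j))"
      by (simp add: sum_distrib_right mult.assoc)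
    also have "\<dots> = (\<Sum>A\<in>U n. \<Sum>j<d. coord A i * (functional (s A) j * orb X $ j))"
      by (rule sum.swap)
    also have "\<dots> = (\<Sum>A\<in>U n. coord A i * (\<Sum>j<d. functional (s A) j * orb X $ j))"
      by (simp add: sum_distrib_left)
    also have "\<dots> = (\<Sum>A\<in>U n. coord A i * chi A (c X))"
    proof (intro sum.cong refl)
      fix A assume A: "A \<in> U n"
      show "coord A i * (\<Sum>j<d. functional (s A) j * orb X $ j) = coord A i * chi A (c X)"
      proof (cases "A \<in> support")
        case True
        thus ?thesis using functional_orb[OF X, of "s A"] s[OF A] chi[OF A X] by simp
      next
        case False
        thus ?thesis using i A by (simp add: support_def del: Pow_iff)
      qed
    qed
    also have "\<dots> = orb (c X) $ i" by (rule orb_eq[OF c[OF X], symmetric])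
    finally show "(M *\<^sub>v orb X) $ i = orb (c X) $ i" .
  qed
  thus ?thesis by (intro bexI[of _ M]) (auto simp: M_def)
qed

end

text \<open>A nontrivial automorphism \<open>c\<close> stabilizing the support of \<open>v\<close>
  yields an affine symmetry. If it came from a group element \<open>g\<close>, then \<open>c\<close>
  would be translation by \<open>g\<close>; as \<open>c\<close> fixes the identity, it would be
  trivial.\<close>

lemma cube_group_not_realizable:
  assumes n: "n \<in> {2, 3, 4}"
  shows "\<not> is_affine_symmetry_group_of_orbit_polytope (cube_group n)"
proof
  assume "is_affine_symmetry_group_of_orbit_polytope (cube_group n)"
  then obtain d D v where D: "D \<in> hom (cube_group n) (GL d)" "v \<in> carrier_vec d"
    and iso: "natural_map d (cube_group n) D v \<in>
      iso (cube_group n) (affine_symmetry_group d (orbit_polytope d (cube_group n) D v))"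
    by (auto simp: is_affine_symmetry_group_of_orbit_polytope_def)
  interpret cube_rep n d D v
    by (intro cube_rep.intro orbit_rep.intro group_cube_group orbit_rep_axioms.intro D)
  let ?nat = "natural_map d (cube_group n) D v"
  have inj: "inj_on ?nat (U n)" and surj: "?nat ` U n = affine_symmetries d P"
    using iso by (auto simp: iso_def bij_betw_def affine_symmetry_group_def)
  obtain c s where c: "bij_betw c (U n) (U n)" and s: "bij_betw s (U n) (U n)"
    and chi: "\<And>A X. A \<in> U n \<Longrightarrow> X \<in> U n \<Longrightarrow> chi A (c X) = chi (s A) X"
    and supp: "\<And>A. A \<in> U n \<Longrightarrow> s A \<in> support \<longleftrightarrow> A \<in> support"
    and nontriv: "\<exists>X\<in>U n. c X \<noteq> X"
    by (rule ex_stabilizing_automorphism[OF n, of support], rule that)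
  have cU: "c X \<in> U n" if "X \<in> U n" for X using c that by (rule bij_betwE[rule_format])
  obtain c' where c': "\<And>X. X \<in> U n \<Longrightarrow> c (c' X) = X" "\<And>X. X \<in> U n \<Longrightarrow> c' (c X) = X"
    and c'U: "\<And>X. X \<in> U n \<Longrightarrow> c' X \<in> U n"
    using bij_betw_self_inverse[OF c] by metis
  obtain s' where s': "\<And>X. X \<in> U n \<Longrightarrow> s (s' X) = X" and s'U: "\<And>X. X \<in> U n \<Longrightarrow> s' X \<in> U n"
    using bij_betw_self_inverse[OF s] by metis
  obtain M where M: "M \<in> carrier_mat d d" "\<And>X. X \<in> U n \<Longrightarrow> M *\<^sub>v orb X = orb (c X)"
    using ex_matrix[of c s, OF cU chi supp] by blast
  have chi': "chi A (c' X) = chi (s' A) X" if "A \<in> U n" "X \<in> U n" for A X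
    using chi[OF s'U[OF that(1)] c'U[OF that(2)]] s'[OF that(1)] c'(1)[OF that(2)] by simp
  have supp': "s' A \<in> support \<longleftrightarrow> A \<in> support" if "A \<in> U n" for A
    using supp[OF s'U[OF that]] s'[OF that] by simp
  obtain N where N: "N \<in> carrier_mat d d" "\<And>X. X \<in> U n \<Longrightarrow> N *\<^sub>v orb X = orb (c' X)"
    using ex_matrix[of c' s', OF c'U chi' supp'] by blast
  have "(\<lambda>x\<in>P. M *\<^sub>v x) \<in> affine_symmetries d P"
    by (rule affine_symmetry_if_permutes_orbit[OF M(1) _ N(1), of c c'])
      (use M(2) N(2) cU c'U c' in \<open>simp_all del: Pow_iff\<close>)
  then obtain g where g: "g \<in> U n" "?nat g = (\<lambda>x\<in>P. M *\<^sub>v x)" using surj by (metis imageE)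
  \<comment> \<open>The group is commutative: elements moving \<open>v\<close> to the same point act
    equally on the whole orbit, hence on \<open>P\<close>, and the natural map is injective.\<close>
  have orb_inj: "X = Y" if XY: "X \<in> U n" "Y \<in> U n" "orb X = orb Y" for X Y
  proof -
    have swap: "D Z *\<^sub>v orb W = D W *\<^sub>v orb Z" if "Z \<in> U n" "W \<in> U n" for Z W
      using D_orb[of Z W] D_orb[of W Z] that by (simp add: symd_commute)
    have "D X *\<^sub>v orb Z = D Y *\<^sub>v orb Z + 0\<^sub>v d" if "Z \<in> U n" for Z
      using swap[OF XY(1) that] swap[OF XY(2) that] XY(3) D_carrier[of Z] orb_carrier[of Y] that XY by simp
    hence "D X *\<^sub>v x = D Y *\<^sub>v x + 0\<^sub>v d" if "x \<in> P" for x
      using mat_eq_on_P[of "D X" "D Y" "0\<^sub>v d" x] D_carrier XY that by simp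
    hence "D X *\<^sub>v x = D Y *\<^sub>v x" if "x \<in> P" for x
      using D_carrier[of Y] P_carrier[OF that] XY that by simp
    hence "?nat X = ?nat Y" by (auto simp: natural_map_def)
    thus ?thesis using inj XY by (auto dest: inj_onD)
  qed
  have cg: "c X = g \<triangle> X" if X: "X \<in> U n" for X
  proof -
    have "orb (c X) = ?nat g (orb X)" using M(2)[OF X] g(2) orb_in_P[of X] X by simp
    also have "\<dots> = orb (g \<triangle> X)" using natural_map_orb[of g X] g(1) X by simp
    finally show ?thesis by (intro orb_inj cU X symd_in_U g)
  qed
  \<comment> \<open>Every character takes the value 1 at \<open>c {}\<close>, since
    \<open>chi (s A) {} = 1\<close>.\<close>
  have "c {} = {}"
    by (rule chi_eq_iff[OF _ cU[OF empty_in_U] empty_in_U])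
      (use chi[OF _ empty_in_U] in \<open>simp add: chi_commute[of "c {}"] del: Pow_iff\<close>)
  hence "g = {}" using cg[OF empty_in_U] by simp
  thus False using nontriv cg by auto
qed

theorem theorem9p9:
  fixes G :: "('g, 'm) monoid_scheme" and n :: nat
  assumes "elementary_abelian 2 G" and "order G = 2 ^ n"
  shows "is_affine_symmetry_group_of_orbit_polytope G \<longleftrightarrow> n \<notin> {2, 3, 4}"
proof -
  interpret comm_group G using assms(1) by (simp add: elementary_abelian_def)
  interpret elementary_abelian_2_group G
    using assms(1)
    by unfold_locales (auto simp: elementary_abelian_def numeral_2_eq_2)
  obtain h where h: "h \<in> iso (cube_group n) G" using ex_iso_cube_group[OF assms(2)] by blast
  have "is_affine_symmetry_group_of_orbit_polytope G \<longleftrightarrow>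
      is_affine_symmetry_group_of_orbit_polytope (cube_group n)"
    using realizable_transfer[OF _ h] realizable_transfer[OF _ group.iso_set_sym[OF group_cube_group h]] by blast
  also have "\<dots> \<longleftrightarrow> n \<notin> {2, 3, 4}"
  proof
    assume "is_affine_symmetry_group_of_orbit_polytope (cube_group n)"
    thus "n \<notin> {2, 3, 4}" using cube_group_not_realizable by blast
  next
    assume "n \<notin> {2, 3, 4}"
    hence "n \<le> 1 \<or> n \<ge> 5" by auto
    thus "is_affine_symmetry_group_of_orbit_polytope (cube_group n)"
      using cube_group_realizable_0_1 cube_group_realizable_ge_5 by blast
  qed
  finally show ?thesis .
qed

end
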